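(* Let $T=X+\mathrm{i}Y$ satisfy assumption (A) (stated in the context), and let $r\in L^1([a,b]^2)$ be its principal function (defined in the context). Let $n,m\in\mathbb{N}$, let $c_1,\dots,c_n,d_1,\dots,d_m$ be complex scalars, and let $\alpha_j,\psi_j$ ($1\le j\le n$) and $\phi_k,\beta_k$ ($1\le k\le m$) be in $\mathcal{P}([a,b])$. Set $$\Psi(t,\lambda)=\sum_{j=1}^n c_j\,\alpha_j(t)\psi_j(\lambda),\qquad \Phi(t,\lambda)=\sum_{k=1}^m d_k\,\phi_k(t)\beta_k(\lambda),$$ and $$\Psi(X,Y)=\sum_{j=1}^n c_j\,\alpha_j(X)\psi_j(Y),\qquad \Phi(X,Y)=\sum_{k=1}^m d_k\,\phi_k(X)\beta_k(Y).$$ Then $-\mathrm{i}[\Psi(X,Y),\Phi(X,Y)]\in\mathcal{B}_1(\mathcal{H})$ and $$\mathrm{Tr}\{-\mathrm{i}[\Psi(X,Y),\Phi(X,Y)]\}=\int_{[a,b]^2}-J(\Psi,\Phi)(t,\lambda)\,r(t,\lambda)\,dt\,d\lambda,$$ where $J(\Psi,\Phi)=\frac{\partial\Psi}{\partial t}\frac{\partial\Phi}{\partial\lambda}-\frac{\partial\Psi}{\partial\lambda}\frac{\partial\Phi}{\partial t}$.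
   Context: $\mathcal{H}$ is a separable Hilbert space, $\mathcal{B}(\mathcal{H})$ the bounded linear operators on it, $\mathcal{B}_1(\mathcal{H})$ the trace class operators, $\mathcal{B}_{1+}(\mathcal{H})$ the positive trace class operators, $[A,B]=AB-BA$, and $\mathrm{Tr}$ the trace. $\mathcal{P}([a,b])$ is the set of polynomials with complex coefficients on the compact interval $[a,b]\subseteq\mathbb{R}$. An operator $T$ is hyponormal if $[T^*,T]\ge 0$; a hyponormal $T$ is purely hyponormal if there is no nonzero subspace of $\mathcal{H}$, invariant under $T$, on which the restriction of $T$ is normal. Assumption (A): $T=X+\mathrm{i}Y$, with $X,Y$ bounded self-adjoint, is a purely hyponormal operator in $\mathcal{B}(\mathcal{H})$ such that $[T^*,T]=-2\mathrm{i}[Y,X]=2D^2\in\mathcal{B}_{1+}(\mathcal{H})$, and $\sigma(X)\cup\sigma(Y)\subseteq[a,b]\subseteq\mathbb{R}$. The principal function $r$ is the unique non-negative function in $L^1([a,b]^2)$ such that $\mathrm{Tr}\{-\mathrm{i}[\psi(Y),\phi(X)]\}=\int_{[a,b]^2}\phi'(t)\psi'(\lambda)r(t,\lambda)\,dt\,d\lambda$ for all $\psi,\phi\in\mathcal{P}([a,b])$ (the Carey-Pincus principal function). *)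

theory Defs
  imports "HOL-Analysis.Analysis" "HOL-Computational_Algebra.Polynomial"
begin

text \<open>
  Complex Hilbert spaces. The inner product is linear in its first argument. That \<open>1\<close> acts as the
  identity, that the inner product is definite, and that scaling is compatible with the norm all
  follow from \<open>scaleR_scaleC\<close>, \<open>cinner_self\<close> and the axioms of real normed vector spaces.
\<close>

class complex_hilbert = banach +
  fixes scaleC :: "complex \<Rightarrow> 'a \<Rightarrow> 'a" (infixr "*\<^sub>C" 75)
    and cinner :: "'a \<Rightarrow> 'a \<Rightarrow> complex"
  assumes scaleC_add_right: "c *\<^sub>C (x + y) = c *\<^sub>C x + c *\<^sub>C y"
    and scaleC_add_left: "(c + d) *\<^sub>C x = c *\<^sub>C x + d *\<^sub>C x"
    and scaleC_scaleC: "c *\<^sub>C (d *\<^sub>C x) = (c * d) *\<^sub>C x"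
    and scaleR_scaleC: "r *\<^sub>R x = complex_of_real r *\<^sub>C x"
    and cinner_commute: "cinner x y = cnj (cinner y x)"
    and cinner_add_left: "cinner (x + y) z = cinner x z + cinner y z"
    and cinner_scaleC_left: "cinner (c *\<^sub>C x) y = c * cinner x y"
    and cinner_self: "cinner x x = complex_of_real ((norm x)\<^sup>2)"

text \<open>
  Operators are functions on the whole space; \<open>bounded_op\<close> singles out the elements of
  \<open>B(H)\<close>. Products of operators are compositions.
\<close>

definition bounded_op :: "('a::complex_hilbert \<Rightarrow> 'a) \<Rightarrow> bool" where
  "bounded_op A \<longleftrightarrow> bounded_linear A \<and> (\<forall>c x. A (c *\<^sub>C x) = c *\<^sub>C A x)"

definition commutator :: "('a::complex_hilbert \<Rightarrow> 'a) \<Rightarrow> ('a \<Rightarrow> 'a) \<Rightarrow> 'a \<Rightarrow> 'a" where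
  "commutator A B = (\<lambda>x. A (B x) - B (A x))"

definition op_scale :: "complex \<Rightarrow> ('a::complex_hilbert \<Rightarrow> 'a) \<Rightarrow> 'a \<Rightarrow> 'a" where
  "op_scale c A = (\<lambda>x. c *\<^sub>C A x)"

definition op_poly :: "complex poly \<Rightarrow> ('a::complex_hilbert \<Rightarrow> 'a) \<Rightarrow> 'a \<Rightarrow> 'a" where
  "op_poly p A = (\<lambda>x. \<Sum>i\<le>degree p. coeff p i *\<^sub>C (A ^^ i) x)"

definition adj :: "('a::complex_hilbert \<Rightarrow> 'a) \<Rightarrow> 'a \<Rightarrow> 'a" where
  "adj A = (THE B. \<forall>x y. cinner (A x) y = cinner x (B y))"

definition self_adjoint :: "('a::complex_hilbert \<Rightarrow> 'a) \<Rightarrow> bool" where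
  "self_adjoint A \<longleftrightarrow> bounded_op A \<and> (\<forall>x y. cinner (A x) y = cinner x (A y))"

definition positive_op :: "('a::complex_hilbert \<Rightarrow> 'a) \<Rightarrow> bool" where
  "positive_op A \<longleftrightarrow> bounded_op A \<and> (\<forall>x. cinner (A x) x \<in> \<real> \<and> 0 \<le> Re (cinner (A x) x))"

definition spectrum :: "('a::complex_hilbert \<Rightarrow> 'a) \<Rightarrow> complex set" where
  "spectrum A = {z. \<not> (\<exists>B. bounded_op B \<and>
     (\<forall>x. B (A x - z *\<^sub>C x) = x) \<and> (\<forall>x. A (B x) - z *\<^sub>C B x = x))}"

subsection \<open>Trace class operators\<close>

definition onb :: "'a::complex_hilbert set \<Rightarrow> bool" where
  "onb E \<longleftrightarrow> (\<forall>e\<in>E. \<forall>f\<in>E. cinner e f = (if e = f then 1 else 0)) \<and>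
     (\<forall>x. (\<forall>e\<in>E. cinner x e = 0) \<longrightarrow> x = 0)"

text \<open>\<open>op_abs A\<close> is the positive square root of \<open>A\<^sup>* A\<close>.\<close>

definition op_abs :: "('a::complex_hilbert \<Rightarrow> 'a) \<Rightarrow> 'a \<Rightarrow> 'a" where
  "op_abs A = (THE P. positive_op P \<and> P \<circ> P = adj A \<circ> A)"

definition trace_class :: "('a::complex_hilbert \<Rightarrow> 'a) \<Rightarrow> bool" where
  "trace_class A \<longleftrightarrow> bounded_op A \<and>
     (\<exists>E. onb E \<and> (\<lambda>e. cinner (op_abs A e) e) summable_on E)"

text \<open>On trace class operators the value does not depend on the chosen orthonormal basis.\<close>

definition op_trace :: "('a::complex_hilbert \<Rightarrow> 'a) \<Rightarrow> complex" where
  "op_trace A = (\<Sum>\<^sub>\<infinity>e\<in>(SOME E. onb E). cinner (A e) e)"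

subsection \<open>Hyponormal operators\<close>

definition hyponormal :: "('a::complex_hilbert \<Rightarrow> 'a) \<Rightarrow> bool" where
  "hyponormal T \<longleftrightarrow> bounded_op T \<and> positive_op (commutator (adj T) T)"

definition closed_csubspace :: "'a::complex_hilbert set \<Rightarrow> bool" where
  "closed_csubspace M \<longleftrightarrow> closed M \<and> 0 \<in> M \<and>
     (\<forall>x\<in>M. \<forall>y\<in>M. x + y \<in> M) \<and> (\<forall>c. \<forall>x\<in>M. c *\<^sub>C x \<in> M)"

text \<open>
  For \<open>M\<close> invariant under \<open>T\<close>, the \<open>S\<close> below is the adjoint of the restriction of \<open>T\<close> taken inside
  the Hilbert space \<open>M\<close>; it is in general not the restriction of \<open>adj T\<close>.
\<close>

definition normal_on :: "'a::complex_hilbert set \<Rightarrow> ('a \<Rightarrow> 'a) \<Rightarrow> bool" where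
  "normal_on M T \<longleftrightarrow> (\<exists>S. S ` M \<subseteq> M \<and>
     (\<forall>x\<in>M. \<forall>y\<in>M. cinner (T x) y = cinner x (S y)) \<and>
     (\<forall>x\<in>M. S (T x) = T (S x)))"

definition purely_hyponormal :: "('a::complex_hilbert \<Rightarrow> 'a) \<Rightarrow> bool" where
  "purely_hyponormal T \<longleftrightarrow> hyponormal T \<and>
     \<not> (\<exists>M. closed_csubspace M \<and> M \<noteq> {0} \<and> T ` M \<subseteq> M \<and> normal_on M T)"

definition assumption_A :: "real \<Rightarrow> real \<Rightarrow> ('a::complex_hilbert \<Rightarrow> 'a) \<Rightarrow> ('a \<Rightarrow> 'a) \<Rightarrow> ('a \<Rightarrow> 'a) \<Rightarrow> bool" where
  "assumption_A a b T X Y \<longleftrightarrow>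
     self_adjoint X \<and> self_adjoint Y \<and> T = (\<lambda>x. X x + \<i> *\<^sub>C Y x) \<and>
     purely_hyponormal T \<and>
     (\<exists>D. positive_op D \<and>
        commutator (adj T) T = op_scale (- 2 * \<i>) (commutator Y X) \<and>
        commutator (adj T) T = op_scale 2 (D \<circ> D)) \<and>
     positive_op (commutator (adj T) T) \<and> trace_class (commutator (adj T) T) \<and>
     a \<le> b \<and> spectrum X \<union> spectrum Y \<subseteq> complex_of_real ` {a..b}"

subsection \<open>The principal function\<close>

text \<open>
  As \<open>r\<close> represents an element of \<open>L\<^sup>1\<close>, nonnegativity is required almost everywhere only; the
  trace formula determines \<open>r\<close> up to null sets.
\<close>

definition principal_function ::
  "real \<Rightarrow> real \<Rightarrow> ('a::complex_hilbert \<Rightarrow> 'a) \<Rightarrow> ('a \<Rightarrow> 'a) \<Rightarrow> (real \<times> real \<Rightarrow> real) \<Rightarrow> bool" where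
  "principal_function a b X Y r \<longleftrightarrow>
     integrable (lebesgue_on ({a..b} \<times> {a..b})) r \<and>
     (AE z in lebesgue_on ({a..b} \<times> {a..b}). 0 \<le> r z) \<and>
     (\<forall>\<psi> \<phi>. op_trace (op_scale (- \<i>) (commutator (op_poly \<psi> Y) (op_poly \<phi> X))) =
        (LINT (t, l) | lebesgue_on ({a..b} \<times> {a..b}).
           poly (pderiv \<phi>) (of_real t) * poly (pderiv \<psi>) (of_real l) * of_real (r (t, l))))"

definition jacobian_det :: "(real \<Rightarrow> real \<Rightarrow> complex) \<Rightarrow> (real \<Rightarrow> real \<Rightarrow> complex) \<Rightarrow> real \<Rightarrow> real \<Rightarrow> complex" where
  "jacobian_det F G t l =
     vector_derivative (\<lambda>s. F s l) (at t) * vector_derivative (\<lambda>s. G t s) (at l) -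
     vector_derivative (\<lambda>s. F t s) (at l) * vector_derivative (\<lambda>s. G s l) (at t)"

end

theory Submission
  imports Defs
begin

text \<open>
  Since \<open>[Y, X] = i D\<^sup>2\<close> is of trace class, all commutators in the algebra generated by \<open>X\<close> and \<open>Y\<close> are
  of trace class, and \<open>\<tau>(A, B) = Tr [A, B]\<close> is a skew bilinear form on this algebra. If \<open>S\<close> is of trace
  class then \<open>Tr (S B) = Tr (B S)\<close>; so \<open>\<tau>(A, B)\<close> depends only on the classes of \<open>A\<close> and \<open>B\<close> modulo
  trace class operators, that is, on commuting symbols. The identity
  \<open>[A B, C] = [A, B C] + [B, C A]\<close> then says that \<open>\<tau>\<close> is a derivation in its first argument:
  \<open>\<tau>(f g, h) = \<tau>(f, g h) + \<tau>(g, f h)\<close> for symbols \<open>f\<close>, \<open>g\<close>, \<open>h\<close>.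

  By the chain rule, \<open>\<tau>(\<alpha>(X), \<phi>(X) G) = \<tau>(X, (\<alpha>' \<phi>)(X) G) = \<tau>(q(X), G)\<close> whenever \<open>q' = \<alpha>' \<phi>\<close>, and
  likewise for \<open>Y\<close>. With antiderivatives \<open>q' = \<alpha>' \<phi>\<close> and \<open>w' = \<psi>' \<beta>\<close> this gives
  \<open>\<tau>(\<alpha>(X) \<psi>(Y), \<phi>(X) \<beta>(Y)) = \<tau>(w(Y), (\<phi> \<alpha>)(X)) - \<tau>((\<psi> \<beta>)(Y), q(X))\<close>.
  Both terms are of the kind that the principal function represents as integrals, and the integrand
  is \<open>(\<phi> \<alpha>)' \<psi>' \<beta> - \<alpha>' \<phi> (\<psi> \<beta>)' = \<alpha> \<phi>' \<psi>' \<beta> - \<alpha>' \<phi> \<psi> \<beta>'\<close>, minus the Jacobian determinant. The general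
  case follows by bilinearity. The steps are \<open>trace_form_cong_left\<close>, \<open>trace_form_op_poly\<close>,
  \<open>trace_form_products\<close> and \<open>trace_form_products_integral\<close>.

  The trace calculus is developed for nuclear operators, the series \<open>A x = \<Sum>\<^sub>k \<langle>x, u\<^sub>k\<rangle> v\<^sub>k\<close> with
  \<open>\<Sum>\<^sub>k \<parallel>u\<^sub>k\<parallel> \<parallel>v\<^sub>k\<parallel> < \<infinity>\<close>: they visibly form an ideal, Parseval's identity gives
  \<open>Tr A = \<Sum>\<^sub>k \<langle>v\<^sub>k, u\<^sub>k\<rangle>\<close> in every orthonormal basis, and \<open>Tr (S B) = Tr (B S)\<close> follows by inspection.
  Two links to the trace class are needed. The square of a positive operator with summable
  diagonal is nuclear, which provides the commutator \<open>[Y, X]\<close>. Conversely a nuclear operator \<open>A\<close> with an adjoint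
  is of trace class; this requires the absolute value \<open>\<bar>A\<bar>\<close>, and therefore the existence and
  uniqueness of positive square roots, obtained as the limit of an iteration.
\<close>


section \<open>Complex inner products\<close>

lemma cinner_add_right: "cinner x (y + z) = cinner x y + cinner (x::'a::complex_hilbert) z"
  by (metis cinner_add_left cinner_commute complex_cnj_add)

lemma cinner_scaleC_right: "cinner x (c *\<^sub>C y) = cnj c * cinner (x::'a::complex_hilbert) y"
  by (metis cinner_commute cinner_scaleC_left complex_cnj_mult)

lemma scaleC_of_real: "complex_of_real r *\<^sub>C x = r *\<^sub>R (x::'a::complex_hilbert)"
  by (simp add: scaleR_scaleC)

lemma scaleC_one [simp]: "1 *\<^sub>C x = (x::'a::complex_hilbert)"
  using scaleC_of_real[of 1 x] by simp

lemma scaleC_zero_left [simp]: "0 *\<^sub>C x = (0::'a::complex_hilbert)"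
  using scaleC_of_real[of 0 x] by simp

lemma scaleC_zero_right [simp]: "c *\<^sub>C (0::'a::complex_hilbert) = 0"
  using scaleC_add_right[of c 0 0] by simp

lemma scaleC_minus_right: "c *\<^sub>C (- x) = - (c *\<^sub>C (x::'a::complex_hilbert))"
  using scaleC_add_right[of c x "- x"] by (simp add: eq_neg_iff_add_eq_0 add.commute)

lemma scaleC_minus_left: "(- c) *\<^sub>C x = - (c *\<^sub>C (x::'a::complex_hilbert))"
  using scaleC_add_left[of c "- c" x] by (simp add: eq_neg_iff_add_eq_0 add.commute)

lemma scaleC_minus_one: "(- 1) *\<^sub>C x = - (x::'a::complex_hilbert)"
  by (simp add: scaleC_minus_left)

lemma scaleC_diff_right: "c *\<^sub>C (x - y) = c *\<^sub>C x - c *\<^sub>C (y::'a::complex_hilbert)"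
  by (simp only: diff_conv_add_uminus scaleC_add_right scaleC_minus_right)

lemma scaleC_sum_right: "c *\<^sub>C (\<Sum>i\<in>I. f i) = (\<Sum>i\<in>I. c *\<^sub>C (f i::'a::complex_hilbert))"
  by (induction I rule: infinite_finite_induct) (auto simp: scaleC_add_right)

lemma cinner_zero_left [simp]: "cinner 0 (x::'a::complex_hilbert) = 0"
  using cinner_add_left[of 0 0 x] by simp

lemma cinner_zero_right [simp]: "cinner (x::'a::complex_hilbert) 0 = 0"
  using cinner_add_right[of x 0 0] by simp

lemma cinner_minus_left: "cinner (- x) y = - cinner (x::'a::complex_hilbert) y"
  using cinner_scaleC_left[of "-1" x y] by (simp add: scaleC_minus_one)

lemma cinner_minus_right: "cinner x (- y) = - cinner (x::'a::complex_hilbert) y"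
  using cinner_scaleC_right[of x "-1" y] by (simp add: scaleC_minus_one)

lemma cinner_diff_left: "cinner (x - y) z = cinner x z - cinner (y::'a::complex_hilbert) z"
  by (simp only: diff_conv_add_uminus cinner_add_left cinner_minus_left)

lemma cinner_diff_right: "cinner x (y - z) = cinner x y - cinner (x::'a::complex_hilbert) z"
  by (simp only: diff_conv_add_uminus cinner_add_right cinner_minus_right)

lemma cinner_scaleR_left: "cinner (r *\<^sub>R x) y = of_real r * cinner (x::'a::complex_hilbert) y"
  by (simp add: scaleR_scaleC cinner_scaleC_left)

lemma cinner_scaleR_right: "cinner x (r *\<^sub>R y) = of_real r * cinner (x::'a::complex_hilbert) y"
  by (simp add: scaleR_scaleC cinner_scaleC_right)

lemma cinner_sum_left: "cinner (\<Sum>i\<in>I. f i) y = (\<Sum>i\<in>I. cinner (f i) (y::'a::complex_hilbert))"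
  by (induction I rule: infinite_finite_induct) (auto simp: cinner_add_left)

lemma cinner_sum_right: "cinner y (\<Sum>i\<in>I. f i) = (\<Sum>i\<in>I. cinner (y::'a::complex_hilbert) (f i))"
  by (induction I rule: infinite_finite_induct) (auto simp: cinner_add_right)

lemma cinner_self_eq_0 [simp]: "cinner x x = 0 \<longleftrightarrow> (x::'a::complex_hilbert) = 0"
  by (simp add: cinner_self)

lemma cinner_extensionality: "(\<And>x. cinner x y = cinner x z) \<Longrightarrow> (y::'a::complex_hilbert) = z"
  by (metis cinner_diff_right cinner_self_eq_0 right_minus_eq)

lemma mult_cnj_self: "z * cnj z = (complex_of_real (cmod z))\<^sup>2"
  using complex_norm_square[of z] by simp

lemma norm_scaleC: "norm (c *\<^sub>C x) = cmod c * norm (x::'a::complex_hilbert)"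
proof -
  have "complex_of_real ((norm (c *\<^sub>C x))\<^sup>2) = (c * cnj c) * complex_of_real ((norm x)\<^sup>2)"
    by (simp only: cinner_self[symmetric] cinner_scaleC_left cinner_scaleC_right mult_ac)
  also have "\<dots> = complex_of_real ((cmod c * norm x)\<^sup>2)"
    by (simp add: mult_cnj_self power_mult_distrib)
  finally have "(norm (c *\<^sub>C x))\<^sup>2 = (cmod c * norm x)\<^sup>2"
    by (simp only: of_real_eq_iff)
  then show ?thesis
    by (simp add: power2_eq_iff_nonneg)
qed

lemma cinner_Cauchy_Schwarz: "cmod (cinner x y) \<le> norm x * norm (y::'a::complex_hilbert)"
proof (cases "y = 0")
  case False
  define c where "c = cinner x y / complex_of_real ((norm y)\<^sup>2)"
  have ny: "complex_of_real ((norm y)\<^sup>2) \<noteq> 0" using False by simp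
  have cy: "cinner y x = cnj (cinner x y)" by (rule cinner_commute)
  have "complex_of_real ((norm (x - c *\<^sub>C y))\<^sup>2) = cinner (x - c *\<^sub>C y) (x - c *\<^sub>C y)"
    by (simp only: cinner_self)
  also have "\<dots> = cinner x x - cnj c * cinner x y - c * cinner y x + c * (cnj c * cinner y y)"
    by (simp add: cinner_diff_left cinner_diff_right cinner_scaleC_left cinner_scaleC_right
        algebra_simps)
  also have "\<dots> = complex_of_real ((norm x)\<^sup>2) - cinner x y * cnj (cinner x y) / complex_of_real ((norm y)\<^sup>2)"
    using ny unfolding c_def cinner_self cy by (simp add: field_simps)
  also have "\<dots> = complex_of_real ((norm x)\<^sup>2 - (cmod (cinner x y))\<^sup>2 / (norm y)\<^sup>2)"
    by (simp add: mult_cnj_self)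
  finally have "(norm x)\<^sup>2 - (cmod (cinner x y))\<^sup>2 / (norm y)\<^sup>2 = (norm (x - c *\<^sub>C y))\<^sup>2"
    by (simp only: of_real_eq_iff)
  then have "(cmod (cinner x y))\<^sup>2 / (norm y)\<^sup>2 \<le> (norm x)\<^sup>2"
    by (metis diff_ge_0_iff_ge zero_le_power2)
  then have "(cmod (cinner x y))\<^sup>2 \<le> (norm x * norm y)\<^sup>2"
    using False by (simp add: divide_le_eq power_mult_distrib)
  then show ?thesis
    by (simp add: power2_le_iff_abs_le)
qed simp

lemma bounded_linear_cinner_left: "bounded_linear (\<lambda>x. cinner x (y::'a::complex_hilbert))"
  by (rule bounded_linear_intro[where K = "norm y"])
    (auto simp: cinner_add_left cinner_scaleR_left scaleR_conv_of_real cinner_Cauchy_Schwarz)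

lemma bounded_linear_cinner_right: "bounded_linear (\<lambda>y. cinner (x::'a::complex_hilbert) y)"
  by (rule bounded_linear_intro[where K = "norm x"])
    (auto simp: cinner_add_right cinner_scaleR_right scaleR_conv_of_real mult.commute
      intro: order_trans[OF cinner_Cauchy_Schwarz])

lemma bounded_linear_scaleC_right: "bounded_linear (\<lambda>x::'a::complex_hilbert. c *\<^sub>C x)"
  by (rule bounded_linear_intro[where K = "cmod c"])
    (auto simp: scaleC_add_right scaleR_scaleC scaleC_scaleC norm_scaleC mult.commute)

lemmas tendsto_cinner_left = bounded_linear.tendsto[OF bounded_linear_cinner_left]
lemmas tendsto_cinner_right = bounded_linear.tendsto[OF bounded_linear_cinner_right]
lemmas tendsto_scaleC_right = bounded_linear.tendsto[OF bounded_linear_scaleC_right]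


section \<open>Orthonormal bases\<close>

lemma onb_norm_sum:
  assumes E: "onb (E::'a::complex_hilbert set)" and F: "finite F" "F \<subseteq> E"
  shows "(norm (\<Sum>e\<in>F. a e *\<^sub>C e))\<^sup>2 = (\<Sum>e\<in>F. (cmod (a e))\<^sup>2)"
proof -
  have "cinner (\<Sum>e\<in>F. a e *\<^sub>C e) (\<Sum>e\<in>F. a e *\<^sub>C e)
      = (\<Sum>e\<in>F. \<Sum>f\<in>F. a e * (cnj (a f) * cinner e f))"
    unfolding cinner_sum_left
    by (simp add: cinner_sum_right cinner_scaleC_left cinner_scaleC_right sum_distrib_left mult.left_commute)
  also have "\<dots> = (\<Sum>e\<in>F. \<Sum>f\<in>F. if e = f then a e * cnj (a e) else 0)"
    using E F by (intro sum.cong refl) (simp add: onb_def subset_iff)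
  also have "\<dots> = complex_of_real (\<Sum>e\<in>F. (cmod (a e))\<^sup>2)"
    using F by (simp add: mult_cnj_self)
  finally show ?thesis
    unfolding cinner_self by (simp only: of_real_eq_iff)
qed

lemma Bessel_inequality:
  assumes E: "onb (E::'a::complex_hilbert set)" and F: "finite F" "F \<subseteq> E"
  shows "(\<Sum>e\<in>F. (cmod (cinner x e))\<^sup>2) \<le> (norm x)\<^sup>2"
proof -
  define y where "y = (\<Sum>e\<in>F. cinner x e *\<^sub>C e)"
  have ny: "(norm y)\<^sup>2 = (\<Sum>e\<in>F. (cmod (cinner x e))\<^sup>2)"
    unfolding y_def by (rule onb_norm_sum[OF E F])
  have "cinner x y = (\<Sum>e\<in>F. cnj (cinner x e) * cinner x e)"
    by (simp add: y_def cinner_sum_right cinner_scaleC_right)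
  also have "\<dots> = complex_of_real ((norm y)\<^sup>2)"
    unfolding ny by (simp add: mult_cnj_self mult.commute[of "cnj _"])
  finally have "(norm y)\<^sup>2 = cmod (cinner x y)" by (simp add: norm_power)
  also have "\<dots> \<le> norm x * norm y" by (rule cinner_Cauchy_Schwarz)
  finally have "norm y \<le> norm x"
    by (cases "norm y = 0") (auto simp: power2_eq_square mult_le_cancel_right)
  then show ?thesis
    unfolding ny[symmetric] by (rule power_mono) simp
qed

lemma Bessel_product:
  assumes E: "onb (E::'a::complex_hilbert set)" and F: "finite F" "F \<subseteq> E"
  shows "(\<Sum>e\<in>F. cmod (cinner v e * cinner e u)) \<le> norm u * norm v"
proof -
  have L2: "L2_set (\<lambda>e. cmod (cinner x e)) F \<le> norm x" for x
    using Bessel_inequality[OF E F, of x] by (simp add: L2_set_def real_le_lsqrt)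
  have "(\<Sum>e\<in>F. cmod (cinner v e * cinner e u)) = (\<Sum>e\<in>F. \<bar>cmod (cinner v e)\<bar> * \<bar>cmod (cinner u e)\<bar>)"
    by (intro sum.cong refl) (simp add: norm_mult cinner_commute[of _ u])
  also have "\<dots> \<le> L2_set (\<lambda>e. cmod (cinner v e)) F * L2_set (\<lambda>e. cmod (cinner u e)) F"
    by (rule L2_set_mult_ineq)
  also have "\<dots> \<le> norm v * norm u"
    by (intro mult_mono L2) (auto simp: L2_set_nonneg)
  finally show ?thesis by (simp add: mult.commute)
qed

text \<open>The net of partial sums is Cauchy, because by orthogonality the squared distance between two of
  them is a sum of \<open>\<bar>\<langle>x, e\<rangle>\<bar>\<^sup>2\<close> over the symmetric difference of the index sets, and Bessel's
  inequality makes these numbers summable. The limit has the same coefficients as \<open>x\<close>,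
  so it is \<open>x\<close> by totality.\<close>

lemma onb_expansion:
  assumes E: "onb (E::'a::complex_hilbert set)"
  shows "((\<lambda>e. cinner x e *\<^sub>C e) has_sum x) E"
proof -
  let ?f = "\<lambda>e. cinner x e *\<^sub>C e" and ?g = "\<lambda>e. (cmod (cinner x e))\<^sup>2"
  have "?g summable_on E"
    by (rule nonneg_bdd_above_summable_on)
      (auto intro!: bdd_aboveI[where M = "(norm x)\<^sup>2"] Bessel_inequality[OF E])
  then obtain s where s: "(?g has_sum s) E"
    by (auto simp: summable_on_def)
  have g_le: "sum ?g F \<le> s" if "finite F" "F \<subseteq> E" for F
    using s that by (intro has_sum_mono_neutral[OF has_sum_finite[of F] s]) auto
  have cauchy: "\<exists>P. eventually P (finite_subsets_at_top E) \<and>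
      (\<forall>F G. P F \<and> P G \<longrightarrow> dist (sum ?f F) (sum ?f G) < e)" if "e > 0" for e
  proof -
    define P where "P F \<longleftrightarrow> finite F \<and> F \<subseteq> E \<and>
      (\<forall>G. finite G \<and> G \<subseteq> E - F \<longrightarrow> (norm (sum ?f G))\<^sup>2 < (e / 2)\<^sup>2)" for F
    have "(sum ?g \<longlongrightarrow> s) (finite_subsets_at_top E)"
      using s by (simp add: has_sum_def)
    then have "eventually (\<lambda>F. sum ?g F > s - (e / 2)\<^sup>2) (finite_subsets_at_top E)"
      by (rule order_tendstoD) (use that in simp)
    then have "eventually P (finite_subsets_at_top E)"
      using eventually_finite_subsets_at_top_weakI[of E "\<lambda>F. finite F \<and> F \<subseteq> E", simplified]
    proof eventually_elim
      case (elim F)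
      have "(norm (sum ?f G))\<^sup>2 < (e / 2)\<^sup>2" if G: "finite G" "G \<subseteq> E - F" for G
      proof -
        have "sum ?g (F \<union> G) = sum ?g F + sum ?g G"
          using elim G by (intro sum.union_disjoint) auto
        moreover have "sum ?g (F \<union> G) \<le> s" using elim G by (intro g_le) auto
        ultimately have "sum ?g G < (e / 2)\<^sup>2" using elim by simp
        then show ?thesis using onb_norm_sum[OF E, of G "cinner x"] G by (metis Diff_subset order_trans)
      qed
      then show ?case using elim by (auto simp: P_def)
    qed
    moreover have "dist (sum ?f F) (sum ?f G) < e" if "P F" "P G" for F G
    proof -
      have fin: "finite F" "finite G" "F \<subseteq> E" "G \<subseteq> E" using that by (auto simp: P_def)
      have "sum ?f F = sum ?f (F \<inter> G) + sum ?f (F - G)"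
        by (rule sum.Int_Diff[OF fin(1)])
      moreover have "sum ?f G = sum ?f (F \<inter> G) + sum ?f (G - F)"
        using sum.Int_Diff[OF fin(2), of ?f F] by (simp add: Int_commute)
      ultimately have "dist (sum ?f F) (sum ?f G) = norm (sum ?f (F - G) - sum ?f (G - F))"
        by (simp add: dist_norm)
      moreover have "norm (sum ?f (F - G)) < e / 2"
        using that(2) fin \<open>e > 0\<close> unfolding P_def by (intro power2_less_imp_less[of _ "e/2"]) auto
      moreover have "norm (sum ?f (G - F)) < e / 2"
        using that(1) fin \<open>e > 0\<close> unfolding P_def by (intro power2_less_imp_less[of _ "e/2"]) auto
      ultimately show ?thesis
        using norm_triangle_ineq4[of "sum ?f (F - G)" "sum ?f (G - F)"] by linarith
    qed
    ultimately show ?thesis by blast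
  qed
  then have "cauchy_filter (filtermap (sum ?f) (finite_subsets_at_top E))"
    by (simp add: cauchy_filter_metric_filtermap)
  moreover have "complete (UNIV::'a set)"
    by (meson Cauchy_convergent UNIV_I complete_def convergent_def)
  ultimately obtain y where "(sum ?f \<longlongrightarrow> y) (finite_subsets_at_top E)"
    using complete_uniform[where S=UNIV] by (force simp add: filterlim_def)
  then have y: "(?f has_sum y) E" by (simp add: has_sum_def)
  have "cinner (x - y) e = 0" if "e \<in> E" for e
  proof -
    have "((\<lambda>f. cinner (?f f) e) has_sum cinner y e) E"
      by (rule has_sum_bounded_linear[OF bounded_linear_cinner_left y])
    moreover have "((\<lambda>f. cinner (?f f) e) has_sum cinner x e) {e}"
      using that E by (intro has_sum_finiteI) (auto simp: onb_def cinner_scaleC_left)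
    then have "((\<lambda>f. cinner (?f f) e) has_sum cinner x e) E"
      by (rule has_sum_cong_neutral[THEN iffD1, rotated -1])
        (use that E in \<open>auto simp: onb_def cinner_scaleC_left\<close>)
    ultimately show ?thesis
      by (simp add: cinner_diff_left has_sum_unique)
  qed
  then have "x - y = 0" using E unfolding onb_def by blast
  then have "x = y" by simp
  then show ?thesis using y by simp
qed

lemma Parseval_identity:
  assumes "onb (E::'a::complex_hilbert set)"
  shows "((\<lambda>e. cinner v e * cinner e u) has_sum cinner v u) E"
  using has_sum_bounded_linear[OF bounded_linear_cinner_left onb_expansion[OF assms, of v], of u]
  by (simp add: cinner_scaleC_left)


section \<open>Positive operators and their square roots\<close>

lemma bounded_opI:
  fixes A :: "'a::complex_hilbert \<Rightarrow> 'a"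
  assumes "\<And>x y. A (x + y) = A x + A y" "\<And>c x. A (c *\<^sub>C x) = c *\<^sub>C A x"
    and "\<And>x. norm (A x) \<le> norm x * K"
  shows "bounded_op A"
  unfolding bounded_op_def
  by (auto intro!: bounded_linear_intro[of A K] simp: assms scaleR_scaleC)

lemma bounded_op_linear: "bounded_op A \<Longrightarrow> bounded_linear A"
  and bounded_op_scaleC: "bounded_op A \<Longrightarrow> A (c *\<^sub>C x) = c *\<^sub>C A x"
  by (auto simp: bounded_op_def)

lemma bounded_op_add: "bounded_op A \<Longrightarrow> A (x + y) = A x + A y"
  and bounded_op_diff: "bounded_op A \<Longrightarrow> A (x - y) = A x - A y"
  and bounded_op_zero: "bounded_op A \<Longrightarrow> A 0 = 0"
  and bounded_op_scaleR: "bounded_op A \<Longrightarrow> A (t *\<^sub>R x) = t *\<^sub>R A x"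
  by (auto simp: bounded_op_def linear_simps)

lemma bounded_op_bound:
  assumes "bounded_op A"
  obtains K where "K > 0" "\<And>x. norm (A x) \<le> K * norm x"
  using bounded_linear.pos_bounded[OF bounded_op_linear[OF assms]] by (auto simp: mult.commute)

lemma bounded_op_id: "bounded_op (\<lambda>x. x)"
  by (simp add: bounded_op_def bounded_linear_ident)

lemma bounded_op_plus: "bounded_op A \<Longrightarrow> bounded_op B \<Longrightarrow> bounded_op (\<lambda>x. A x + B x)"
  by (auto simp: bounded_op_def bounded_linear_add scaleC_add_right)

lemma bounded_op_minus: "bounded_op A \<Longrightarrow> bounded_op B \<Longrightarrow> bounded_op (\<lambda>x. A x - B x)"
  by (auto simp: bounded_op_def bounded_linear_sub scaleC_diff_right)

lemma bounded_op_scale: "bounded_op A \<Longrightarrow> bounded_op (\<lambda>x. c *\<^sub>C A x)"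
  by (simp add: bounded_op_def scaleC_scaleC mult.commute
      bounded_linear_compose[OF bounded_linear_scaleC_right])

lemma bounded_op_scaleR_op: "bounded_op A \<Longrightarrow> bounded_op (\<lambda>x. t *\<^sub>R A x)"
  using bounded_op_scale[of A "complex_of_real t"] by (simp add: scaleC_of_real)

lemma bounded_op_comp: "bounded_op A \<Longrightarrow> bounded_op B \<Longrightarrow> bounded_op (\<lambda>x. A (B x))"
  by (simp add: bounded_op_def bounded_linear_compose[of A B])

lemma adj_eqI:
  assumes "\<And>x y. cinner (A x) y = cinner x (B y)"
  shows "adj A = B"
  unfolding adj_def
proof (rule the_equality)
  fix B' assume "\<forall>x y. cinner (A x) y = cinner x (B' y)"
  then show "B' = B"
    by (intro ext cinner_extensionality) (simp add: assms[symmetric])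
qed (use assms in simp)

lemma positive_op_bounded: "positive_op A \<Longrightarrow> bounded_op A"
  and positive_op_ge0: "positive_op A \<Longrightarrow> 0 \<le> Re (cinner (A x) x)"
  and positive_op_real: "positive_op A \<Longrightarrow> cinner (A x) x = complex_of_real (Re (cinner (A x) x))"
  by (auto simp: positive_op_def complex_is_Real_iff complex_eq_iff)

text \<open>Polarization: the form \<open>\<langle>A x, x\<rangle>\<close> is real at \<open>x + y\<close> and at \<open>x + i y\<close>, which gives
  the imaginary and the real part of \<open>\<langle>A x, y\<rangle> = \<langle>x, A y\<rangle>\<close>.\<close>

lemma positive_op_symmetric:
  fixes A :: "'a::complex_hilbert \<Rightarrow> 'a"
  assumes A: "positive_op A"
  shows "cinner (A x) y = cinner x (A y)"
proof -
  note b = positive_op_bounded[OF A]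
  have im: "Im (cinner (A z) z) = 0" for z
    using positive_op_real[OF A, of z] by (metis Im_complex_of_real)
  have "Im (cinner (A (x + y)) (x + y)) = Im (cinner (A x) y + cinner (A y) x)"
    by (simp add: bounded_op_add[OF b] cinner_add_left cinner_add_right im)
  moreover have "Im (cinner (A (x + \<i> *\<^sub>C y)) (x + \<i> *\<^sub>C y)) = Im (\<i> * (cinner (A y) x - cinner (A x) y))"
    by (simp add: bounded_op_add[OF b] bounded_op_scaleC[OF b] cinner_add_left cinner_add_right
        cinner_scaleC_left cinner_scaleC_right im algebra_simps)
  ultimately have "cinner (A x) y = cnj (cinner (A y) x)"
    by (simp add: im complex_eq_iff)
  then show ?thesis by (simp add: cinner_commute[symmetric])
qed

text \<open>The form \<open>\<langle>A y, y\<rangle>\<close> is nonnegative at \<open>y = x - A x / M\<close>. Expanding it and bounding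
  \<open>\<langle>A (A x), A x\<rangle>\<close> by \<open>M \<parallel>A x\<parallel>\<^sup>2\<close> leaves \<open>0 \<le> \<langle>A x, x\<rangle> - \<parallel>A x\<parallel>\<^sup>2 / M\<close>.\<close>

lemma positive_op_norm_sq_le:
  fixes A :: "'a::complex_hilbert \<Rightarrow> 'a"
  assumes A: "positive_op A" and "M > 0" and M: "\<And>x. Re (cinner (A x) x) \<le> M * (norm x)\<^sup>2"
  shows "(norm (A x))\<^sup>2 \<le> M * Re (cinner (A x) x)"
proof -
  note b = positive_op_bounded[OF A]
  define t where "t = 1 / M"
  have t: "t * M = 1" "t > 0" using \<open>M > 0\<close> by (auto simp: t_def)
  have n: "Re (cinner (A x) (A x)) = (norm (A x))\<^sup>2" by (simp add: cinner_self)
  have s: "cinner (A (A x)) x = cinner (A x) (A x)" by (rule positive_op_symmetric[OF A])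
  have "0 \<le> Re (cinner (A (x - t *\<^sub>R A x)) (x - t *\<^sub>R A x))"
    by (rule positive_op_ge0[OF A])
  also have "\<dots> = Re (cinner (A x) x) - 2 * t * (norm (A x))\<^sup>2 + t * (t * Re (cinner (A (A x)) (A x)))"
    by (simp add: bounded_op_diff[OF b] bounded_op_scaleR[OF b] cinner_diff_left cinner_diff_right
        cinner_scaleR_left cinner_scaleR_right n s right_diff_distrib)
  also have "\<dots> \<le> Re (cinner (A x) x) - 2 * t * (norm (A x))\<^sup>2 + t * (t * (M * (norm (A x))\<^sup>2))"
    using M[of "A x"] t by (intro add_left_mono mult_left_mono) auto
  also have "\<dots> = Re (cinner (A x) x) - t * (norm (A x))\<^sup>2"
    using t(1) by (simp add: algebra_simps flip: mult.assoc) 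
  finally have "M * (t * (norm (A x))\<^sup>2) \<le> M * Re (cinner (A x) x)"
    using \<open>M > 0\<close> by (intro mult_left_mono) auto
  then show ?thesis using t by (simp add: mult.assoc[symmetric] mult.commute)
qed

lemma positive_op_Re_le:
  assumes "\<And>x. norm (A x) \<le> M * norm (x::'a::complex_hilbert)"
  shows "Re (cinner (A x) x) \<le> M * (norm x)\<^sup>2"
proof -
  have "Re (cinner (A x) x) \<le> norm (A x) * norm x"
    using complex_Re_le_cmod cinner_Cauchy_Schwarz by (rule order_trans)
  also have "\<dots> \<le> M * norm x * norm x"
    by (rule mult_right_mono[OF assms]) simp
  finally show ?thesis by (simp add: power2_eq_square mult.assoc)
qed

text \<open>Expand the square and absorb half of the linear term, using
  \<open>t \<parallel>B x\<parallel>\<^sup>2 \<le> \<langle>B x, x\<rangle>\<close>. The estimate makes \<open>I - t B\<close> a contraction for the construction of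
  the square root, and it also controls the powers of \<open>I - t B\<close>.\<close>

lemma positive_op_relaxation:
  fixes B :: "'a::complex_hilbert \<Rightarrow> 'a"
  assumes B: "positive_op B" and M: "M > 0" "\<And>x. norm (B x) \<le> M * norm x" and t: "t * M = 1"
  shows "(norm (x - t *\<^sub>R B x))\<^sup>2 \<le> (norm x)\<^sup>2 - t * Re (cinner (B x) x)"
proof -
  have t0: "t > 0" using M(1) t by (metis zero_less_mult_pos2 zero_less_one)
  have "(norm (B x))\<^sup>2 \<le> M * Re (cinner (B x) x)"
    by (rule positive_op_norm_sq_le[OF B M(1)]) (rule positive_op_Re_le[OF M(2)])
  then have "t * (norm (B x))\<^sup>2 \<le> t * (M * Re (cinner (B x) x))"
    using t0 by (intro mult_left_mono) auto
  then have *: "t * (norm (B x))\<^sup>2 \<le> Re (cinner (B x) x)"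
    by (simp add: t flip: mult.assoc)
  let ?c = "x - t *\<^sub>R B x"
  have "complex_of_real ((norm ?c)\<^sup>2) = cinner ?c ?c" by (simp add: cinner_self)
  also have "\<dots> = cinner x x - of_real t * (cinner (B x) x + cinner (B x) x)
      + of_real t * (of_real t * cinner (B x) (B x))"
    by (simp add: cinner_diff_left cinner_diff_right cinner_scaleR_left cinner_scaleR_right
        positive_op_symmetric[OF B, of x x, symmetric] algebra_simps)
  finally have "Re (complex_of_real ((norm ?c)\<^sup>2)) = Re \<dots>" by simp
  then have "(norm ?c)\<^sup>2 = (norm x)\<^sup>2 - 2 * t * Re (cinner (B x) x) + t * (t * (norm (B x))\<^sup>2)"
    by (simp add: cinner_self)
  also have "\<dots> \<le> (norm x)\<^sup>2 - 2 * t * Re (cinner (B x) x) + t * Re (cinner (B x) x)"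
    using * t0 by (intro add_left_mono mult_left_mono) auto
  finally show ?thesis by (simp add: algebra_simps)
qed

text \<open>The square root of \<open>I - C\<close> is \<open>I - Q\<close>, where \<open>Q\<close> is the limit of this iteration: a fixed point
  satisfies \<open>2 Q = C + Q\<^sup>2\<close>, which says \<open>(I - Q)\<^sup>2 = I - C\<close>.\<close>

primrec sqrt_iter :: "('a::real_vector \<Rightarrow> 'a) \<Rightarrow> nat \<Rightarrow> 'a \<Rightarrow> 'a" where
  "sqrt_iter C 0 = (\<lambda>x. 0)"
| "sqrt_iter C (Suc n) = (\<lambda>x. (1/2) *\<^sub>R (C x + sqrt_iter C n (sqrt_iter C n x)))"

text \<open>The same iteration for the number \<open>C = 1\<close>; it dominates the operator iteration in norm.\<close>

primrec sqrt_iter_bound :: "nat \<Rightarrow> real" where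
  "sqrt_iter_bound 0 = 0"
| "sqrt_iter_bound (Suc n) = (1/2) * (1 + (sqrt_iter_bound n)\<^sup>2)"

lemma sqrt_iter_bound_range: "0 \<le> sqrt_iter_bound n \<and> sqrt_iter_bound n \<le> 1"
  by (induction n) (auto simp: power_le_one)

lemma sqrt_iter_bounded_op: "bounded_op C \<Longrightarrow> bounded_op (sqrt_iter C n)"
proof (induction n)
  case 0
  then show ?case by (simp add: bounded_op_def bounded_linear_zero)
next
  case (Suc n)
  then show ?case
    unfolding sqrt_iter.simps
    by (intro bounded_op_scaleR_op bounded_op_plus bounded_op_comp[of "sqrt_iter C n" "sqrt_iter C n"]) simp_all
qed

lemma sqrt_iter_commute:
  assumes "bounded_linear L" "\<And>x. L (C x) = C (L x)"
  shows "L (sqrt_iter C n x) = sqrt_iter C n (L x)"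
  by (induction n arbitrary: x) (simp_all add: assms linear_simps[OF assms(1)])

lemma sqrt_iter_symmetric:
  fixes C :: "'a::complex_hilbert \<Rightarrow> 'a"
  assumes "\<And>x y. cinner (C x) y = cinner x (C y)"
  shows "cinner (sqrt_iter C n x) y = cinner x (sqrt_iter C n y)"
  by (induction n arbitrary: x y)
    (simp_all add: assms cinner_scaleR_left cinner_scaleR_right cinner_add_left cinner_add_right)

lemma sqrt_iter_norm:
  fixes C :: "'a::complex_hilbert \<Rightarrow> 'a"
  assumes "\<And>x. norm (C x) \<le> norm x"
  shows "norm (sqrt_iter C n x) \<le> sqrt_iter_bound n * norm x"
proof (induction n arbitrary: x)
  case (Suc n)
  let ?Q = "sqrt_iter C n" and ?q = "sqrt_iter_bound n"
  have "norm (?Q (?Q x)) \<le> ?q * (?q * norm x)"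
    using Suc[of "?Q x"] Suc[of x] sqrt_iter_bound_range[of n]
    by (meson mult_left_mono order_trans)
  then have "norm (C x + ?Q (?Q x)) \<le> norm x + ?q * (?q * norm x)"
    using assms[of x] by (intro norm_triangle_le) linarith
  then show ?case by (simp add: power2_eq_square algebra_simps del: scaleR_add_right)
qed simp

text \<open>Since \<open>Q\<^sub>n\<close> and \<open>Q\<^sub>n\<^sub>+\<^sub>1\<close> commute, \<open>Q\<^sub>n\<^sub>+\<^sub>2 - Q\<^sub>n\<^sub>+\<^sub>1 = (Q\<^sub>n\<^sub>+\<^sub>1 + Q\<^sub>n) (Q\<^sub>n\<^sub>+\<^sub>1 - Q\<^sub>n) / 2\<close>, and the same
  identity holds for the bounds.\<close>

lemma sqrt_iter_step_norm:
  fixes C :: "'a::complex_hilbert \<Rightarrow> 'a"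
  assumes C: "bounded_op C" "\<And>x. norm (C x) \<le> norm x"
  shows "norm (sqrt_iter C (Suc n) x - sqrt_iter C n x)
    \<le> (sqrt_iter_bound (Suc n) - sqrt_iter_bound n) * norm x"
proof (induction n arbitrary: x)
  case 0
  then show ?case using C(2)[of x] by simp
next
  case (Suc n)
  define Q R where "Q = sqrt_iter C n" and "R = sqrt_iter C (Suc n)"
  define q r where "q = sqrt_iter_bound n" and "r = sqrt_iter_bound (Suc n)"
  have bQ: "bounded_op Q" and bR: "bounded_op R"
    unfolding Q_def R_def by (intro sqrt_iter_bounded_op C(1))+
  have QC: "Q (C x) = C (Q x)" for x
    unfolding Q_def by (rule sqrt_iter_commute[symmetric]) (auto intro: bounded_op_linear C(1))
  have QR: "Q (R x) = R (Q x)" for x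
    unfolding R_def by (rule sqrt_iter_commute) (auto intro: bounded_op_linear bQ QC)
  have "sqrt_iter C (Suc (Suc n)) x - sqrt_iter C (Suc n) x = (1/2) *\<^sub>R (R (R x) - Q (Q x))"
    by (simp add: R_def Q_def scaleR_diff_right[symmetric])
  also have "R (R x) - Q (Q x) = R (R x - Q x) + Q (R x - Q x)"
    by (simp add: bounded_op_diff[OF bQ] bounded_op_diff[OF bR] QR)
  finally have eq: "sqrt_iter C (Suc (Suc n)) x - sqrt_iter C (Suc n) x
      = (1/2) *\<^sub>R (R (R x - Q x) + Q (R x - Q x))" .
  have "norm (R (R x - Q x) + Q (R x - Q x)) \<le> r * norm (R x - Q x) + q * norm (R x - Q x)"
    using sqrt_iter_norm[OF C(2), of "Suc n" "R x - Q x"] sqrt_iter_norm[OF C(2), of n "R x - Q x"]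
    unfolding R_def[symmetric] Q_def[symmetric] r_def[symmetric] q_def[symmetric]
    by (intro norm_triangle_le) linarith
  also have "\<dots> = (r + q) * norm (R x - Q x)" by (simp add: algebra_simps)
  also have "\<dots> \<le> (r + q) * ((r - q) * norm x)"
    using Suc[of x] sqrt_iter_bound_range[of n] sqrt_iter_bound_range[of "Suc n"]
    unfolding R_def[symmetric] Q_def[symmetric] r_def[symmetric] q_def[symmetric]
    by (intro mult_left_mono) auto
  finally have "norm ((1/2) *\<^sub>R (R (R x - Q x) + Q (R x - Q x))) \<le> (1/2) * ((r + q) * (r - q)) * norm x"
    by simp
  moreover have "sqrt_iter_bound (Suc (Suc n)) - r = (1/2) * ((r + q) * (r - q))"
    by (simp add: r_def q_def power2_eq_square algebra_simps)
  ultimately show ?case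
    unfolding eq r_def[symmetric] by presburger
qed

lemma sqrt_iter_convergent:
  fixes C :: "'a::complex_hilbert \<Rightarrow> 'a"
  assumes C: "bounded_op C" "\<And>x. norm (C x) \<le> norm x"
  shows "convergent (\<lambda>n. sqrt_iter C n x)"
proof -
  let ?q = sqrt_iter_bound
  have "?q n \<le> ?q (Suc n)" for n
  proof -
    have "0 \<le> (1 - ?q n)\<^sup>2" by simp
    then show ?thesis by (simp add: power2_diff)
  qed
  then have "incseq ?q" by (rule incseq_SucI)
  then have "convergent ?q"
    using sqrt_iter_bound_range by (intro Bseq_mono_convergent BseqI'[where K = 1]) (auto simp: incseq_def)
  then have "summable (\<lambda>n. ?q (Suc n) - ?q n)"
    unfolding convergent_def by (blast intro: telescope_summable)
  then have "summable (\<lambda>n. (?q (Suc n) - ?q n) * norm x)" by (rule summable_mult2)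
  then have "summable (\<lambda>n. sqrt_iter C (Suc n) x - sqrt_iter C n x)"
    by (rule summable_comparison_test') (rule sqrt_iter_step_norm[OF C])
  then have "convergent (\<lambda>n. \<Sum>i<n. sqrt_iter C (Suc i) x - sqrt_iter C i x)"
    by (simp add: summable_iff_convergent)
  then show ?thesis
    unfolding sum_lessThan_telescope[of "\<lambda>n. sqrt_iter C n x"] by (simp del: sqrt_iter.simps(2))
qed

text \<open>The root is a strong limit of polynomials in \<open>C\<close>, so it commutes with everything that commutes
  with \<open>C\<close>; uniqueness of the root rests on this.\<close>

lemma sqrt_of_contraction:
  fixes C :: "'a::complex_hilbert \<Rightarrow> 'a"
  assumes C: "bounded_op C" "\<And>x. norm (C x) \<le> norm x"
    and sym: "\<And>x y. cinner (C x) y = cinner x (C y)"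
  obtains P where "positive_op P" "\<And>x. P (P x) = x - C x"
    "\<And>L x. bounded_linear L \<Longrightarrow> (\<And>x. L (C x) = C (L x)) \<Longrightarrow> L (P x) = P (L x)"
proof -
  define Q where "Q x = lim (\<lambda>n. sqrt_iter C n x)" for x
  let ?S = "sqrt_iter C"
  have lim: "(\<lambda>n. ?S n x) \<longlonglongrightarrow> Q x" for x
    unfolding Q_def using sqrt_iter_convergent[OF C, of x] by (simp add: convergent_LIMSEQ_iff)
  note bS = sqrt_iter_bounded_op[OF C(1)]
  have S_le: "norm (?S n x) \<le> norm x" for n x
    using sqrt_iter_norm[OF C(2), of n x] sqrt_iter_bound_range[of n]
    by (meson mult_left_le_one_le norm_ge_zero order_trans)
  have Q_le: "norm (Q x) \<le> norm x" for x
    by (rule LIMSEQ_le_const2[OF tendsto_norm[OF lim]]) (auto intro: S_le)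
  have bQ: "bounded_op Q"
  proof (rule bounded_opI[where K = 1])
    fix x y
    have "(\<lambda>n. ?S n x + ?S n y) \<longlonglongrightarrow> Q x + Q y" by (intro tendsto_add lim)
    then show "Q (x + y) = Q x + Q y"
      using lim[of "x + y"] by (simp add: bounded_op_add[OF bS] LIMSEQ_unique)
  next
    fix c x
    have "(\<lambda>n. c *\<^sub>C ?S n x) \<longlonglongrightarrow> c *\<^sub>C Q x" by (intro tendsto_scaleC_right lim)
    then show "Q (c *\<^sub>C x) = c *\<^sub>C Q x"
      using lim[of "c *\<^sub>C x"] by (simp add: bounded_op_scaleC[OF bS] LIMSEQ_unique)
  qed (use Q_le in simp)
  have QQ: "(\<lambda>n. ?S n (?S n x)) \<longlonglongrightarrow> Q (Q x)" for x
  proof -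
    have "(\<lambda>n. ?S n (?S n x - Q x)) \<longlonglongrightarrow> 0"
    proof (rule Lim_null_comparison)
      show "\<forall>\<^sub>F n in sequentially. norm (?S n (?S n x - Q x)) \<le> norm (?S n x - Q x)"
        using S_le by simp
      show "(\<lambda>n. norm (?S n x - Q x)) \<longlonglongrightarrow> 0"
        using lim[of x] by (simp add: tendsto_norm_zero LIM_zero)
    qed
    from tendsto_add[OF this lim[of "Q x"]] show ?thesis
      by (simp add: bounded_op_diff[OF bS])
  qed
  have fix_eq: "Q x = (1/2) *\<^sub>R (C x + Q (Q x))" for x
  proof (rule LIMSEQ_unique)
    show "(\<lambda>n. ?S (Suc n) x) \<longlonglongrightarrow> Q x" using lim[of x] by (rule LIMSEQ_Suc)
    show "(\<lambda>n. ?S (Suc n) x) \<longlonglongrightarrow> (1/2) *\<^sub>R (C x + Q (Q x))"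
      by (auto intro!: tendsto_intros QQ)
  qed
  have Qsym: "cinner (Q x) y = cinner x (Q y)" for x y
  proof (rule LIMSEQ_unique)
    show "(\<lambda>n. cinner (?S n x) y) \<longlonglongrightarrow> cinner (Q x) y" by (rule tendsto_cinner_left[OF lim])
    show "(\<lambda>n. cinner (?S n x) y) \<longlonglongrightarrow> cinner x (Q y)"
      unfolding sqrt_iter_symmetric[OF sym] by (rule tendsto_cinner_right[OF lim])
  qed
  define P where "P x = x - Q x" for x
  show thesis
  proof
    have "cinner (P x) x \<in> \<real> \<and> 0 \<le> Re (cinner (P x) x)" for x
    proof -
      have "cinner (Q x) x = cnj (cinner (Q x) x)"
        using Qsym[of x x] cinner_commute[of "Q x" x] by simp
      then have "cinner (Q x) x \<in> \<real>" by (simp add: Reals_cnj_iff)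
      then have "cinner (P x) x \<in> \<real>"
        by (auto simp: P_def cinner_diff_left cinner_self complex_is_Real_iff)
      moreover have "Re (cinner (Q x) x) \<le> (norm x)\<^sup>2"
        using positive_op_Re_le[of Q 1] Q_le by simp
      ultimately show ?thesis by (simp add: P_def cinner_diff_left cinner_self)
    qed
    moreover have "bounded_op P"
      unfolding P_def by (intro bounded_op_minus bounded_op_id bQ)
    ultimately show "positive_op P" by (simp add: positive_op_def)
    fix x
    have "2 *\<^sub>R Q x = 2 *\<^sub>R ((1/2) *\<^sub>R (C x + Q (Q x)))" using fix_eq[of x] by simp
    then have "2 *\<^sub>R Q x = C x + Q (Q x)" by simp
    then show "P (P x) = x - C x"
      unfolding P_def bounded_op_diff[OF bQ] scaleR_2 by (simp add: algebra_simps)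
  next
    fix L :: "'a \<Rightarrow> 'a" and x
    assume L: "bounded_linear L" "\<And>x. L (C x) = C (L x)"
    have "L (Q x) = Q (L x)"
    proof (rule LIMSEQ_unique)
      show "(\<lambda>n. L (?S n x)) \<longlonglongrightarrow> L (Q x)" by (rule bounded_linear.tendsto[OF L(1) lim])
      have "L (?S n x) = ?S n (L x)" for n by (rule sqrt_iter_commute) (use L in auto)
      then show "(\<lambda>n. L (?S n x)) \<longlonglongrightarrow> Q (L x)" using lim[of "L x"] by simp
    qed
    then show "L (P x) = P (L x)" by (simp add: P_def linear_simps[OF L(1)])
  qed
qed

text \<open>For small \<open>t\<close> the operator \<open>C = I - t B\<close> is a contraction and \<open>I - C = t B\<close>.\<close>

lemma positive_op_sqrt:
  fixes B :: "'a::complex_hilbert \<Rightarrow> 'a"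
  assumes B: "positive_op B"
  obtains P where "positive_op P" "\<And>x. P (P x) = B x"
    "\<And>L x. bounded_linear L \<Longrightarrow> (\<And>x. L (B x) = B (L x)) \<Longrightarrow> L (P x) = P (L x)"
proof -
  note bB = positive_op_bounded[OF B]
  obtain M where M: "M > 0" "\<And>x. norm (B x) \<le> M * norm x"
    using bounded_op_bound[OF bB] by blast
  define t where "t = 1 / M"
  have t: "t > 0" "t * M = 1" using M by (auto simp: t_def)
  define C where "C x = x - t *\<^sub>R B x" for x
  have bC: "bounded_op C"
    unfolding C_def by (intro bounded_op_minus bounded_op_id bounded_op_scaleR_op bB)
  have C_le: "norm (C x) \<le> norm x" for x
  proof -
    have "(norm (C x))\<^sup>2 \<le> (norm x)\<^sup>2 - t * Re (cinner (B x) x)"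
      unfolding C_def by (rule positive_op_relaxation[OF B M t(2)])
    also have "\<dots> \<le> (norm x)\<^sup>2" using t(1) positive_op_ge0[OF B, of x] by simp
    finally show ?thesis by (simp add: power2_le_iff_abs_le)
  qed
  have symC: "cinner (C x) y = cinner x (C y)" for x y
    by (simp add: C_def cinner_diff_left cinner_diff_right cinner_scaleR_left cinner_scaleR_right
        positive_op_symmetric[OF B])
  obtain P where P: "positive_op P" "\<And>x. P (P x) = x - C x"
    "\<And>L x. bounded_linear L \<Longrightarrow> (\<And>x. L (C x) = C (L x)) \<Longrightarrow> L (P x) = P (L x)"
    using sqrt_of_contraction[OF bC C_le symC] by blast
  note bP = positive_op_bounded[OF P(1)]
  have sM: "sqrt M * sqrt M = M" using M(1) by simp
  show thesis
  proof
    show "positive_op (\<lambda>x. sqrt M *\<^sub>R P x)"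
      using P(1) M(1) by (auto simp: positive_op_def cinner_scaleR_left intro: bounded_op_scaleR_op)
    have "sqrt M * (sqrt M * t) = 1" using t(2) sM by (metis mult.assoc mult.commute)
    then show "sqrt M *\<^sub>R P (sqrt M *\<^sub>R P x) = B x" for x
      by (simp add: bounded_op_scaleR[OF bP] P(2) C_def)
    show "L (sqrt M *\<^sub>R P x) = sqrt M *\<^sub>R P (L x)"
      if "bounded_linear L" "\<And>x. L (B x) = B (L x)" for L x
    proof -
      have "L (P x) = P (L x)"
        by (rule P(3)[OF that(1)]) (simp add: C_def linear_simps[OF that(1)] that(2))
      then show ?thesis by (simp add: linear_simps[OF that(1)])
    qed
  qed
qed

text \<open>Let \<open>R\<close> be another root. It commutes with \<open>B = R\<^sup>2\<close>, hence with the root \<open>P\<close> constructed above, so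
  \<open>(P + R) (P - R) = 0\<close>. For \<open>z = (P - R) x\<close> this gives \<open>\<langle>P z, z\<rangle> = \<langle>R z, z\<rangle> = 0\<close>, hence \<open>P z = R z = 0\<close>
  and \<open>\<parallel>z\<parallel>\<^sup>2 = \<langle>(P - R) z, x\<rangle> = 0\<close>.\<close>

lemma positive_op_sqrt_unique:
  fixes B :: "'a::complex_hilbert \<Rightarrow> 'a"
  assumes B: "positive_op B"
  obtains P where "positive_op P" "\<And>x. P (P x) = B x"
    "\<And>R. positive_op R \<Longrightarrow> (\<And>x. R (R x) = B x) \<Longrightarrow> R = P"
proof -
  obtain P where P: "positive_op P" "\<And>x. P (P x) = B x"
    "\<And>L x. bounded_linear L \<Longrightarrow> (\<And>x. L (B x) = B (L x)) \<Longrightarrow> L (P x) = P (L x)"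
    using positive_op_sqrt[OF B] by blast
  have zero: "S z = 0" if S: "positive_op S" "Re (cinner (S z) z) = 0" for S and z :: 'a
  proof -
    obtain M where M: "M > 0" "\<And>x. norm (S x) \<le> M * norm x"
      using bounded_op_bound[OF positive_op_bounded[OF S(1)]] by blast
    then have "(norm (S z))\<^sup>2 \<le> M * Re (cinner (S z) z)"
      by (intro positive_op_norm_sq_le[OF S(1)] positive_op_Re_le)
    then show ?thesis using S(2) by simp
  qed
  show thesis
  proof (rule that[OF P(1,2)])
    fix R assume R: "positive_op R" "\<And>x. R (R x) = B x"
    note bP = positive_op_bounded[OF P(1)] and bR = positive_op_bounded[OF R(1)]
    have "R (B x) = B (R x)" for x by (simp flip: R(2))
    then have RP: "R (P x) = P (R x)" for x by (rule P(3)[OF bounded_op_linear[OF bR]])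
    show "R = P"
    proof
      fix x
      define z where "z = P x - R x"
      have "P z + R z = 0"
        by (simp add: z_def bounded_op_diff[OF bP] bounded_op_diff[OF bR] RP P(2) R(2))
      then have "Re (cinner (P z) z) + Re (cinner (R z) z) = 0"
        by (metis cinner_add_left cinner_zero_left plus_complex.simps(1) zero_complex.simps(1))
      then have "Re (cinner (P z) z) = 0" "Re (cinner (R z) z) = 0"
        using positive_op_ge0[OF P(1), of z] positive_op_ge0[OF R(1), of z] by auto
      then have "P z = 0" "R z = 0"
        using zero P(1) R(1) by blast+
      then have "cinner z z = 0"
        using positive_op_symmetric[OF P(1), of z x] positive_op_symmetric[OF R(1), of z x]
        using cinner_diff_right[of z "P x" "R x"] by (simp add: z_def[symmetric])
      then show "R x = P x" by (simp add: z_def)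
    qed
  qed
qed

lemma positive_op_adj_comp:
  fixes A :: "'a::complex_hilbert \<Rightarrow> 'a"
  assumes "bounded_op A" "bounded_op B" "\<And>x y. cinner (A x) y = cinner x (B y)"
  shows "positive_op (\<lambda>x. B (A x))"
proof -
  have "cinner (B (A x)) x = complex_of_real ((norm (A x))\<^sup>2)" for x
    by (metis assms(3) cinner_commute cinner_self complex_cnj_complex_of_real)
  then show ?thesis
    by (auto simp: positive_op_def intro: bounded_op_comp assms)
qed

lemma op_abs_sqrt:
  fixes A :: "'a::complex_hilbert \<Rightarrow> 'a"
  assumes "bounded_op A" "bounded_op B" "\<And>x y. cinner (A x) y = cinner x (B y)"
  shows "positive_op (op_abs A)" and "op_abs A (op_abs A x) = B (A x)"
proof -
  obtain P where P: "positive_op P" "\<And>x. P (P x) = B (A x)"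
    "\<And>R. positive_op R \<Longrightarrow> (\<And>x. R (R x) = B (A x)) \<Longrightarrow> R = P"
    using positive_op_sqrt_unique[OF positive_op_adj_comp[OF assms]] by blast
  have "op_abs A = P"
    unfolding op_abs_def adj_eqI[OF assms(3)]
    by (rule the_equality) (auto simp: fun_eq_iff P(1,2) intro!: P(3)[unfolded fun_eq_iff, rule_format])
  then show "positive_op (op_abs A)" "op_abs A (op_abs A x) = B (A x)"
    by (simp_all add: P)
qed

lemma op_abs_positive:
  fixes A :: "'a::complex_hilbert \<Rightarrow> 'a"
  assumes A: "positive_op A"
  shows "op_abs A = A"
proof -
  note * = positive_op_bounded[OF A] positive_op_bounded[OF A] positive_op_symmetric[OF A]
  obtain P where P: "\<And>R. positive_op R \<Longrightarrow> (\<And>x. R (R x) = A (A x)) \<Longrightarrow> R = P"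
    using positive_op_sqrt_unique[OF positive_op_adj_comp[OF *]] by metis
  show ?thesis
    using P[OF A] P[OF op_abs_sqrt[OF *]] by simp
qed


section \<open>Nuclear operators and their trace\<close>

text \<open>The defining condition of the trace class involves \<open>\<bar>A\<bar>\<close> and is awkward for sums and products.
  Absolutely convergent series of operators of rank one are closed under sums and under products with
  operators that have an adjoint, and their trace can be read off from the terms.\<close>

definition nuclear_rep :: "(nat \<Rightarrow> 'a) \<Rightarrow> (nat \<Rightarrow> 'a) \<Rightarrow> ('a::complex_hilbert \<Rightarrow> 'a) \<Rightarrow> bool" where
  "nuclear_rep u v A \<longleftrightarrow> (\<lambda>k. norm (u k) * norm (v k)) summable_on UNIV \<and>
     (\<forall>x. ((\<lambda>k. cinner x (u k) *\<^sub>C v k) has_sum A x) UNIV)"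

definition nuclear :: "('a::complex_hilbert \<Rightarrow> 'a) \<Rightarrow> bool" where
  "nuclear A \<longleftrightarrow> (\<exists>u v. nuclear_rep u v A)"

text \<open>A relation rather than \<open>adj\<close>, because it asserts that the adjoint exists and it passes
  directly to sums and products.\<close>

definition adjoint_pair :: "('a::complex_hilbert \<Rightarrow> 'a) \<Rightarrow> ('a \<Rightarrow> 'a) \<Rightarrow> bool" where
  "adjoint_pair A B \<longleftrightarrow> bounded_op A \<and> bounded_op B \<and> (\<forall>x y. cinner (A x) y = cinner x (B y))"

text \<open>Absolute summability of \<open>\<langle>v\<^sub>k, e\<rangle> \<langle>e, u\<^sub>k\<rangle>\<close> over all pairs \<open>(k, e)\<close> is Bessel's inequality, summed over
  \<open>k\<close>. Summing over \<open>e\<close> first gives \<open>\<Sum>\<^sub>k \<langle>v\<^sub>k, u\<^sub>k\<rangle>\<close> by Parseval, summing over \<open>k\<close> first gives the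
  trace in the basis \<open>E\<close>.\<close>

lemma nuclear_rep_trace:
  fixes A :: "'a::complex_hilbert \<Rightarrow> 'a"
  assumes E: "onb E" and A: "nuclear_rep u v A"
  obtains s where "((\<lambda>k. cinner (v k) (u k)) has_sum s) UNIV"
    and "((\<lambda>e. cinner (A e) e) has_sum s) E"
proof -
  define f where "f = (\<lambda>(k, e). cinner (v k) e * cinner e (u k))"
  have fk: "(\<lambda>e. norm (f (k, e))) summable_on E"
    and fk_le: "(\<Sum>\<^sub>\<infinity>e\<in>E. norm (f (k, e))) \<le> norm (u k) * norm (v k)" for k
  proof -
    show *: "(\<lambda>e. norm (f (k, e))) summable_on E"
      by (rule nonneg_bdd_above_summable_on)
        (auto simp: f_def intro!: bdd_aboveI[where M = "norm (u k) * norm (v k)"] Bessel_product[OF E])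
    show "(\<Sum>\<^sub>\<infinity>e\<in>E. norm (f (k, e))) \<le> norm (u k) * norm (v k)"
      by (rule infsum_le_finite_sums[OF *]) (auto simp: f_def intro: Bessel_product[OF E])
  qed
  have "(\<lambda>k. \<Sum>\<^sub>\<infinity>e\<in>E. norm (f (k, e))) summable_on UNIV"
    by (rule summable_on_comparison_test[where f = "\<lambda>k. norm (u k) * norm (v k)"])
      (use A fk_le in \<open>auto simp: nuclear_rep_def intro: infsum_nonneg\<close>)
  then have "(\<lambda>z. norm (f z)) summable_on (UNIV \<times> E)"
    using fk unfolding Infinite_Sum.abs_summable_on_Sigma_iff by (simp add: infsum_nonneg)
  then obtain s where s: "(f has_sum s) (UNIV \<times> E)"
    using abs_summable_summable by (auto simp: summable_on_def)
  have "((\<lambda>k. cinner (v k) (u k)) has_sum s) UNIV"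
    by (rule has_sum_Sigma'[OF s]) (simp add: f_def Parseval_identity[OF E])
  moreover have s': "((\<lambda>(e, k). f (k, e)) has_sum s) (E \<times> UNIV)"
    using s by (subst (asm) has_sum_swap)
  have "((\<lambda>k. cinner (v k) e * cinner e (u k)) has_sum cinner (A e) e) UNIV" for e
  proof -
    have "((\<lambda>k. cinner e (u k) *\<^sub>C v k) has_sum A e) UNIV"
      using A by (simp add: nuclear_rep_def)
    from has_sum_bounded_linear[OF bounded_linear_cinner_left this, of e] show ?thesis
      by (simp add: cinner_scaleC_left mult.commute)
  qed
  then have "((\<lambda>e. cinner (A e) e) has_sum s) E"
    by (intro has_sum_Sigma'[OF s']) (simp add: f_def)
  ultimately show thesis by (rule that)
qed

lemma op_trace_nuclear_rep:
  fixes A :: "'a::complex_hilbert \<Rightarrow> 'a"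
  assumes "onb (E::'a set)" and A: "nuclear_rep u v A"
  shows "op_trace A = (\<Sum>\<^sub>\<infinity>k. cinner (v k) (u k))"
proof -
  have E: "onb (SOME E::'a set. onb E)" using assms(1) by (rule someI)
  obtain s where s: "((\<lambda>k. cinner (v k) (u k)) has_sum s) UNIV"
    and "((\<lambda>e. cinner (A e) e) has_sum s) (SOME E. onb E)"
    using nuclear_rep_trace[OF E A] .
  then have "op_trace A = s" unfolding op_trace_def by (intro infsumI)
  moreover have "(\<Sum>\<^sub>\<infinity>k. cinner (v k) (u k)) = s" by (rule infsumI[OF s])
  ultimately show ?thesis by simp
qed

lemma op_trace_add:
  fixes A B :: "'a::complex_hilbert \<Rightarrow> 'a"
  assumes "onb (E::'a set)" and "nuclear A" and "nuclear B"
  shows "op_trace (\<lambda>x. A x + B x) = op_trace A + op_trace B"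
proof -
  have E: "onb (SOME E::'a set. onb E)" using assms(1) by (rule someI)
  have "(\<lambda>e. cinner (S e) e) summable_on (SOME E. onb E)" if S: "nuclear S" for S :: "'a \<Rightarrow> 'a"
  proof -
    obtain u v where "nuclear_rep u v S" using S by (auto simp: nuclear_def)
    from nuclear_rep_trace[OF E this] show ?thesis by (auto simp: summable_on_def)
  qed
  then show ?thesis
    unfolding op_trace_def cinner_add_left using assms(2,3) by (intro infsum_add) blast+
qed

lemma op_trace_scale: "op_trace (\<lambda>x. c *\<^sub>C A x) = c * op_trace A"
  unfolding op_trace_def cinner_scaleC_left by (rule infsum_cmult_right')

lemma nuclear_rep_comp_left:
  fixes A :: "'a::complex_hilbert \<Rightarrow> 'a"
  assumes A: "nuclear_rep u v A" and B: "bounded_op B"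
  shows "nuclear_rep u (\<lambda>k. B (v k)) (\<lambda>x. B (A x))"
  unfolding nuclear_rep_def
proof (intro conjI allI)
  obtain K where K: "K > 0" "\<And>x. norm (B x) \<le> K * norm x" using bounded_op_bound[OF B] by blast
  show "(\<lambda>k. norm (u k) * norm (B (v k))) summable_on UNIV"
  proof (rule summable_on_comparison_test)
    show "(\<lambda>k. K * (norm (u k) * norm (v k))) summable_on UNIV"
      using A by (auto simp: nuclear_rep_def intro: summable_on_cmult_right)
    show "norm (u k) * norm (B (v k)) \<le> K * (norm (u k) * norm (v k))" for k
      using mult_left_mono[OF K(2)[of "v k"], of "norm (u k)"] by (simp add: mult_ac)
  qed auto
  show "((\<lambda>k. cinner x (u k) *\<^sub>C B (v k)) has_sum B (A x)) UNIV" for x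
  proof -
    have "((\<lambda>k. cinner x (u k) *\<^sub>C v k) has_sum A x) UNIV" using A by (simp add: nuclear_rep_def)
    from has_sum_bounded_linear[OF bounded_op_linear[OF B] this] show ?thesis
      by (simp add: bounded_op_scaleC[OF B])
  qed
qed

lemma nuclear_rep_comp_right:
  fixes A :: "'a::complex_hilbert \<Rightarrow> 'a"
  assumes A: "nuclear_rep u v A" and B: "adjoint_pair B C"
  shows "nuclear_rep (\<lambda>k. C (u k)) v (\<lambda>x. A (B x))"
  unfolding nuclear_rep_def
proof (intro conjI allI)
  have C: "bounded_op C" using B by (simp add: adjoint_pair_def)
  obtain K where K: "K > 0" "\<And>x. norm (C x) \<le> K * norm x" using bounded_op_bound[OF C] by blast
  show "(\<lambda>k. norm (C (u k)) * norm (v k)) summable_on UNIV"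
  proof (rule summable_on_comparison_test)
    show "(\<lambda>k. K * (norm (u k) * norm (v k))) summable_on UNIV"
      using A by (auto simp: nuclear_rep_def intro: summable_on_cmult_right)
    show "norm (C (u k)) * norm (v k) \<le> K * (norm (u k) * norm (v k))" for k
      using mult_right_mono[OF K(2)[of "u k"], of "norm (v k)"] by (simp add: mult_ac)
  qed auto
  show "((\<lambda>k. cinner x (C (u k)) *\<^sub>C v k) has_sum A (B x)) UNIV" for x
  proof -
    have "((\<lambda>k. cinner (B x) (u k) *\<^sub>C v k) has_sum A (B x)) UNIV"
      using A by (simp add: nuclear_rep_def)
    then show ?thesis using B by (simp add: adjoint_pair_def)
  qed
qed

lemma nuclear_comp_left: "nuclear A \<Longrightarrow> bounded_op B \<Longrightarrow> nuclear (\<lambda>x. B (A x))"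
  unfolding nuclear_def using nuclear_rep_comp_left by blast

lemma nuclear_comp_right: "nuclear A \<Longrightarrow> adjoint_pair B C \<Longrightarrow> nuclear (\<lambda>x. A (B x))"
  unfolding nuclear_def using nuclear_rep_comp_right by blast

text \<open>Both sides are \<open>\<Sum>\<^sub>k \<langle>B v\<^sub>k, u\<^sub>k\<rangle>\<close>.\<close>

lemma op_trace_commute:
  fixes A :: "'a::complex_hilbert \<Rightarrow> 'a"
  assumes E: "onb (E::'a set)" and "nuclear A" and B: "adjoint_pair B C"
  shows "op_trace (\<lambda>x. B (A x)) = op_trace (\<lambda>x. A (B x))"
proof -
  obtain u v where A: "nuclear_rep u v A" using assms(2) by (auto simp: nuclear_def)
  have B': "bounded_op B" using B by (simp add: adjoint_pair_def)
  show ?thesis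
    unfolding op_trace_nuclear_rep[OF E nuclear_rep_comp_left[OF A B']]
      op_trace_nuclear_rep[OF E nuclear_rep_comp_right[OF A B]]
    using B by (simp add: adjoint_pair_def)
qed

lemma nuclear_scale: "nuclear A \<Longrightarrow> nuclear (\<lambda>x. c *\<^sub>C A x)"
  using nuclear_comp_left[of A "\<lambda>x. c *\<^sub>C x"] bounded_op_scale[OF bounded_op_id] by blast

lemma has_sum_interleave:
  fixes f :: "nat \<Rightarrow> 'b::topological_comm_monoid_add"
  assumes a: "((\<lambda>k. f (2 * k)) has_sum a) UNIV" and b: "((\<lambda>k. f (2 * k + 1)) has_sum b) UNIV"
  shows "(f has_sum (a + b)) UNIV"
proof -
  have "(f has_sum a) (range (\<lambda>k. 2 * k))"
    using a by (subst has_sum_reindex) (auto simp: inj_on_def o_def)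
  moreover have "(f has_sum b) (range (\<lambda>k. 2 * k + 1))"
    using b by (subst has_sum_reindex) (auto simp: inj_on_def o_def)
  moreover have "range (\<lambda>k::nat. 2 * k) \<inter> range (\<lambda>k. 2 * k + 1) = {}"
    by auto presburger
  ultimately have "(f has_sum (a + b)) (range (\<lambda>k. 2 * k) \<union> range (\<lambda>k. 2 * k + 1))"
    by (rule has_sum_Un_disjoint)
  moreover have "range (\<lambda>k::nat. 2 * k) \<union> range (\<lambda>k. 2 * k + 1) = UNIV"
    by (auto simp: image_iff) presburger
  ultimately show ?thesis by simp
qed

lemma nuclear_add:
  fixes A B :: "'a::complex_hilbert \<Rightarrow> 'a"
  assumes "nuclear A" and "nuclear B"
  shows "nuclear (\<lambda>x. A x + B x)"
proof -
  obtain u v where A: "nuclear_rep u v A" using assms by (auto simp: nuclear_def)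
  obtain u' v' where B: "nuclear_rep u' v' B" using assms by (auto simp: nuclear_def)
  define w where "w = (\<lambda>k. if even k then u (k div 2) else u' (k div 2))"
  define z where "z = (\<lambda>k. if even k then v (k div 2) else v' (k div 2))"
  have [simp]: "w (2 * k) = u k" "z (2 * k) = v k" "w (Suc (2 * k)) = u' k" "z (Suc (2 * k)) = v' k" for k
    by (simp_all add: w_def z_def)
  obtain s t where "((\<lambda>k. norm (u k) * norm (v k)) has_sum s) UNIV"
    "((\<lambda>k. norm (u' k) * norm (v' k)) has_sum t) UNIV"
    using A B by (auto simp: nuclear_rep_def summable_on_def)
  then have "((\<lambda>k. norm (w k) * norm (z k)) has_sum (s + t)) UNIV"
    by (intro has_sum_interleave) simp_all
  moreover have "((\<lambda>k. cinner x (w k) *\<^sub>C z k) has_sum (A x + B x)) UNIV" for x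
    using A B by (intro has_sum_interleave) (simp_all add: nuclear_rep_def)
  ultimately have "nuclear_rep w z (\<lambda>x. A x + B x)"
    by (auto simp: nuclear_rep_def summable_on_def)
  then show ?thesis by (auto simp: nuclear_def)
qed

lemma nuclear_zero: "nuclear (\<lambda>x::'a::complex_hilbert. 0)"
  by (auto simp: nuclear_def nuclear_rep_def intro!: exI[of _ "\<lambda>_. 0"])

lemma op_trace_diff:
  assumes "onb (E::'a::complex_hilbert set)" and "nuclear (A::'a \<Rightarrow> 'a)" and "nuclear B"
  shows "op_trace (\<lambda>x. A x - B x) = op_trace A - op_trace B"
  using op_trace_add[OF assms(1,2) nuclear_scale[OF assms(3), of "-1"]] op_trace_scale[of "-1" B]
  by (simp add: scaleC_minus_one)

lemma op_trace_zero: "op_trace (\<lambda>x::'a::complex_hilbert. 0) = 0"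
  by (simp add: op_trace_def)

lemma nuclear_sum:
  assumes "\<And>i. i \<in> I \<Longrightarrow> nuclear (A i)"
  shows "nuclear (\<lambda>x. \<Sum>i\<in>I. A i x)"
  using assms
  by (induction I rule: infinite_finite_induct) (auto simp: nuclear_zero intro!: nuclear_add)

lemma op_trace_sum:
  assumes E: "onb (E::'a::complex_hilbert set)" and "\<And>i. i \<in> I \<Longrightarrow> nuclear (A i::'a \<Rightarrow> 'a)"
  shows "op_trace (\<lambda>x. \<Sum>i\<in>I. A i x) = (\<Sum>i\<in>I. op_trace (A i))"
  using assms(2)
proof (induction I rule: infinite_finite_induct)
  case (insert i I)
  then have "op_trace (\<lambda>x. A i x + (\<Sum>i\<in>I. A i x)) = op_trace (A i) + (\<Sum>i\<in>I. op_trace (A i))"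
    by (subst op_trace_add[OF E]) (auto intro!: nuclear_sum)
  then show ?case using insert by simp
qed (simp_all add: op_trace_zero)


section \<open>Nuclear operators and the trace class\<close>

text \<open>Applied below to operators \<open>W\<close> for which \<open>\<langle>A e, W e\<rangle>\<close> approximates \<open>\<langle>\<bar>A\<bar> e, e\<rangle>\<close>. Bessel's
  inequality is used for each rank one term, which is why the bound does not depend on \<open>F\<close>.\<close>

lemma nuclear_rep_partial_trace_bound:
  fixes A :: "'a::complex_hilbert \<Rightarrow> 'a"
  assumes E: "onb E" "finite F" "F \<subseteq> E" and A: "nuclear_rep u v A"
    and W: "\<And>x y. cinner x (W y) = cinner (W' x) y" "\<And>x. norm (W' x) \<le> K * norm x"
  shows "cmod (\<Sum>e\<in>F. cinner (A e) (W e)) \<le> K * (\<Sum>\<^sub>\<infinity>k. norm (u k) * norm (v k))"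
proof (rule norm_infsum_le)
  have Ae: "((\<lambda>k. cinner (v k) (W e) * cinner e (u k)) has_sum cinner (A e) (W e)) UNIV" for e
  proof -
    have "((\<lambda>k. cinner e (u k) *\<^sub>C v k) has_sum A e) UNIV"
      using A by (simp add: nuclear_rep_def)
    from has_sum_bounded_linear[OF bounded_linear_cinner_left this, of "W e"] show ?thesis
      by (simp add: cinner_scaleC_left mult.commute)
  qed
  show "((\<lambda>k. \<Sum>e\<in>F. cinner (v k) (W e) * cinner e (u k)) has_sum (\<Sum>e\<in>F. cinner (A e) (W e))) UNIV"
    using \<open>finite F\<close>
    by (induction F rule: finite_induct) (auto intro!: has_sum_add Ae)
  show "((\<lambda>k. K * (norm (u k) * norm (v k))) has_sum K * (\<Sum>\<^sub>\<infinity>k. norm (u k) * norm (v k))) UNIV"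
    using A by (intro has_sum_cmult_right has_sum_infsum) (simp add: nuclear_rep_def)
  show "cmod (\<Sum>e\<in>F. cinner (v k) (W e) * cinner e (u k)) \<le> K * (norm (u k) * norm (v k))" for k
  proof -
    have "cmod (\<Sum>e\<in>F. cinner (v k) (W e) * cinner e (u k))
        \<le> (\<Sum>e\<in>F. cmod (cinner (W' (v k)) e * cinner e (u k)))"
      unfolding W(1) by (rule norm_sum)
    also have "\<dots> \<le> norm (u k) * norm (W' (v k))"
      by (rule Bessel_product[OF E])
    also have "\<dots> \<le> norm (u k) * (K * norm (v k))"
      by (intro mult_left_mono W(2)) simp
    finally show ?thesis by (simp add: mult_ac)
  qed
qed

text \<open>The inequality \<open>\<parallel>R y\<parallel>\<^sup>2 \<le> \<parallel>y\<parallel>\<^sup>2 - t \<langle>P y, y\<rangle>\<close> for \<open>R = I - t P\<close> shows that the numbers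
  \<open>\<langle>P y\<^sub>n, y\<^sub>n\<rangle>\<close>, \<open>y\<^sub>n = R\<^sup>n x\<close>, are bounded by the differences of a convergent sequence.\<close>

lemma positive_op_relaxation_tendsto:
  fixes P :: "'a::complex_hilbert \<Rightarrow> 'a"
  assumes P: "positive_op P" and M: "M > 0" "\<And>x. norm (P x) \<le> M * norm x" and t: "t * M = 1"
  shows "(\<lambda>n. P (((\<lambda>x. x - t *\<^sub>R P x) ^^ n) x)) \<longlonglongrightarrow> 0"
proof -
  have t0: "t > 0" using M(1) t by (metis zero_less_mult_pos2 zero_less_one)
  define y where "y n = ((\<lambda>x. x - t *\<^sub>R P x) ^^ n) x" for n
  have y: "y (Suc n) = y n - t *\<^sub>R P (y n)" for n by (simp add: y_def)
  have step: "(norm (y (Suc n)))\<^sup>2 \<le> (norm (y n))\<^sup>2 - t * Re (cinner (P (y n)) (y n))" for n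
    unfolding y by (rule positive_op_relaxation[OF P M t])
  have "decseq (\<lambda>n. (norm (y n))\<^sup>2)"
  proof (rule decseq_SucI)
    show "(norm (y (Suc n)))\<^sup>2 \<le> (norm (y n))\<^sup>2" for n
      using step[of n] positive_op_ge0[OF P, of "y n"] t0
      by (smt (verit) mult_nonneg_nonneg)
  qed
  then obtain L where L: "(\<lambda>n. (norm (y n))\<^sup>2) \<longlonglongrightarrow> L"
    using decseq_convergent[of "\<lambda>n. (norm (y n))\<^sup>2" 0] by auto
  have lim: "(\<lambda>n. M * (M * ((norm (y n))\<^sup>2 - (norm (y (Suc n)))\<^sup>2))) \<longlonglongrightarrow> M * (M * (L - L))"
    by (intro tendsto_intros L LIMSEQ_Suc[OF L])
  have le: "(norm (P (y n)))\<^sup>2 \<le> M * (M * ((norm (y n))\<^sup>2 - (norm (y (Suc n)))\<^sup>2))" for n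
  proof -
    have "(norm (P (y n)))\<^sup>2 \<le> M * Re (cinner (P (y n)) (y n))"
      by (rule positive_op_norm_sq_le[OF P M(1)]) (rule positive_op_Re_le[OF M(2)])
    also have "Re (cinner (P (y n)) (y n)) = M * (t * Re (cinner (P (y n)) (y n)))"
      using t by (simp add: mult.commute flip: mult.assoc)
    also have "\<dots> \<le> M * ((norm (y n))\<^sup>2 - (norm (y (Suc n)))\<^sup>2)"
      using step[of n] M(1) by (intro mult_left_mono) auto
    finally show ?thesis using M(1) by simp
  qed
  have "(\<lambda>n. (norm (P (y n)))\<^sup>2) \<longlonglongrightarrow> 0"
    by (rule tendsto_sandwich[OF _ _ tendsto_const lim[simplified]]) (use le in \<open>auto intro!: always_eventually\<close>)
  then have "(\<lambda>n. sqrt ((norm (P (y n)))\<^sup>2)) \<longlonglongrightarrow> sqrt 0" by (rule tendsto_real_sqrt)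
  then have "(\<lambda>n. norm (P (y n))) \<longlonglongrightarrow> 0" by simp
  then show ?thesis unfolding y_def by (rule tendsto_norm_zero_cancel)
qed

text \<open>Let \<open>P = \<bar>A\<bar>\<close> and let \<open>G\<^sub>n\<close> be the partial sums of the Neumann series that would invert \<open>P\<close>,
  so that \<open>P G\<^sub>n = I - R\<^sup>n\<close> with a contraction \<open>R\<close>. Then \<open>W\<^sub>n = A G\<^sub>n\<close>, which approximates the
  partial isometry of the polar decomposition, is bounded by 2 because \<open>\<parallel>A z\<parallel> = \<parallel>P z\<parallel>\<close>, and
  \<open>\<langle>W\<^sub>n e, A e\<rangle> = \<langle>P (P G\<^sub>n e), e\<rangle>\<close> tends to \<open>\<langle>P e, e\<rangle>\<close>. The partial traces of \<open>P\<close> are therefore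
  bounded by twice the sum \<open>\<Sum>\<^sub>k \<parallel>u\<^sub>k\<parallel> \<parallel>v\<^sub>k\<parallel>\<close>.\<close>

lemma nuclear_imp_trace_class:
  fixes A :: "'a::complex_hilbert \<Rightarrow> 'a"
  assumes E: "onb (E::'a set)" and "nuclear A" and AB: "adjoint_pair A B"
  shows "trace_class A"
proof -
  obtain u v where A: "nuclear_rep u v A" using assms(2) by (auto simp: nuclear_def)
  have ab: "bounded_op A" "bounded_op B" "\<And>x y. cinner (A x) y = cinner x (B y)"
    using AB by (auto simp: adjoint_pair_def)
  define P where "P = op_abs A"
  have P: "positive_op P" and PP: "P (P x) = B (A x)" for x
    unfolding P_def using op_abs_sqrt[OF ab] by auto
  note bP = positive_op_bounded[OF P] and sP = positive_op_symmetric[OF P]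
  obtain M where M: "M > 0" "\<And>x. norm (P x) \<le> M * norm x"
    using bounded_op_bound[OF bP] by blast
  define t where "t = 1 / M"
  have t: "t * M = 1" "t > 0" using M(1) by (auto simp: t_def)
  define R where "R = (\<lambda>x. x - t *\<^sub>R P x)"
  define G where "G n x = t *\<^sub>R (\<Sum>k<n. (R ^^ k) x)" for n x
  have symR: "cinner ((R ^^ k) x) y = cinner x ((R ^^ k) y)" for k x y
  proof (induction k arbitrary: x y)
    case (Suc k)
    have "cinner (R ((R ^^ k) x)) y = cinner ((R ^^ k) x) (R y)"
      by (simp add: R_def cinner_diff_left cinner_diff_right cinner_scaleR_left cinner_scaleR_right sP)
    then show ?case using Suc[of x "R y"] by (simp add: funpow_swap1)
  qed simp
  have symG: "cinner (G n x) y = cinner x (G n y)" for n x y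
    by (simp add: G_def cinner_scaleR_left cinner_scaleR_right cinner_sum_left cinner_sum_right symR)
  have PG: "P (G n x) = x - (R ^^ n) x" for n x
  proof (induction n)
    case 0
    then show ?case by (simp add: G_def bounded_op_zero[OF bP])
  next
    case (Suc n)
    have "P (G (Suc n) x) = P (G n x) + t *\<^sub>R P ((R ^^ n) x)"
      by (simp add: G_def scaleR_add_right bounded_op_add[OF bP] bounded_op_scaleR[OF bP])
    also have "\<dots> = x - (R ^^ Suc n) x" by (simp add: Suc R_def)
    finally show ?case .
  qed
  have R_le: "norm ((R ^^ n) x) \<le> norm x" for n x
  proof (induction n)
    case (Suc n)
    let ?y = "(R ^^ n) x"
    have "(norm (R ?y))\<^sup>2 \<le> (norm ?y)\<^sup>2 - t * Re (cinner (P ?y) ?y)"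
      unfolding R_def by (rule positive_op_relaxation[OF P M t(1)])
    also have "\<dots> \<le> (norm ?y)\<^sup>2" using t(2) positive_op_ge0[OF P, of ?y] by simp
    finally have "norm (R ?y) \<le> norm ?y" by (simp add: power2_le_iff_abs_le)
    then show ?case using Suc by simp
  qed simp
  define W where "W n x = A (G n x)" for n x
  have W_le: "norm (W n x) \<le> 2 * norm x" for n x
  proof -
    have "complex_of_real ((norm (W n x))\<^sup>2) = complex_of_real ((norm (P (G n x)))\<^sup>2)"
      unfolding W_def cinner_self[symmetric] by (simp add: ab(3) sP PP)
    then have "(norm (W n x))\<^sup>2 = (norm (P (G n x)))\<^sup>2" by (simp only: of_real_eq_iff)
    then have "norm (W n x) = norm (x - (R ^^ n) x)" by (simp add: PG)
    also have "\<dots> \<le> norm x + norm ((R ^^ n) x)" by (rule norm_triangle_ineq4)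
    finally show ?thesis using R_le[of n x] by simp
  qed
  define W' where "W' n x = G n (B x)" for n x
  have WW': "cinner x (W n y) = cinner (W' n x) y" for n x y
    unfolding W_def W'_def symG by (metis ab(3) cinner_commute)
  have W'_le: "norm (W' n x) \<le> 2 * norm x" for n x
  proof -
    have "complex_of_real ((norm (W' n x))\<^sup>2) = cinner x (W n (W' n x))"
      by (simp add: WW' cinner_self)
    then have "(norm (W' n x))\<^sup>2 = cmod (cinner x (W n (W' n x)))"
      by (metis abs_of_nonneg norm_of_real zero_le_power2)
    also have "\<dots> \<le> norm x * norm (W n (W' n x))" by (rule cinner_Cauchy_Schwarz)
    also have "\<dots> \<le> norm x * (2 * norm (W' n x))" by (intro mult_left_mono W_le) simp
    finally show ?thesis
      by (cases "norm (W' n x) = 0") (auto simp: power2_eq_square mult_le_cancel_right)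
  qed
  let ?S = "\<Sum>\<^sub>\<infinity>k. norm (u k) * norm (v k)"
  have bound: "(\<Sum>e\<in>F. Re (cinner (P e) e)) \<le> 2 * ?S" if F: "finite F" "F \<subseteq> E" for F
  proof (rule LIMSEQ_le_const2)
    have lim: "(\<lambda>n. Re (cinner (P (P (G n e))) e)) \<longlonglongrightarrow> Re (cinner (P e) e)" for e
    proof -
      have "(\<lambda>n. P e - P ((R ^^ n) e)) \<longlonglongrightarrow> P e - 0"
        unfolding R_def by (intro tendsto_intros positive_op_relaxation_tendsto[OF P M t(1)])
      then have "(\<lambda>n. P (P (G n e))) \<longlonglongrightarrow> P e"
        by (simp add: PG bounded_op_diff[OF bP])
      then show ?thesis by (intro tendsto_Re tendsto_cinner_left)
    qed
    have *: "Re (cinner (P (P (G n e))) e) = Re (cinner (A e) (W n e))" for n e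
    proof -
      have "cinner (P (P (G n e))) e = cnj (cinner e (B (W n e)))"
        unfolding PP W_def by (rule cinner_commute)
      then show ?thesis by (simp add: ab(3))
    qed
    show "(\<lambda>n. \<Sum>e\<in>F. Re (cinner (A e) (W n e))) \<longlonglongrightarrow> (\<Sum>e\<in>F. Re (cinner (P e) e))"
      using lim unfolding * by (rule tendsto_sum)
    have "(\<Sum>e\<in>F. Re (cinner (A e) (W n e))) \<le> 2 * ?S" for n
    proof -
      have "(\<Sum>e\<in>F. Re (cinner (A e) (W n e))) \<le> cmod (\<Sum>e\<in>F. cinner (A e) (W n e))"
        unfolding Re_sum[symmetric] by (rule complex_Re_le_cmod)
      also have "\<dots> \<le> 2 * ?S"
        by (rule nuclear_rep_partial_trace_bound[OF E F A WW' W'_le])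
      finally show ?thesis .
    qed
    then show "\<exists>N. \<forall>n\<ge>N. (\<Sum>e\<in>F. Re (cinner (A e) (W n e))) \<le> 2 * ?S" by blast
  qed
  have "(\<lambda>e. Re (cinner (P e) e)) summable_on E"
    by (rule nonneg_bdd_above_summable_on)
      (auto intro!: bdd_aboveI[where M = "2 * ?S"] bound positive_op_ge0[OF P])
  then have "(\<lambda>e. complex_of_real (Re (cinner (P e) e))) summable_on E"
    by (rule summable_on_of_real)
  then have "(\<lambda>e. cinner (P e) e) summable_on E"
    by (simp flip: positive_op_real[OF P])
  then show ?thesis
    unfolding trace_class_def P_def using ab(1) E by blast
qed

text \<open>Expanding \<open>D x\<close> in the basis gives \<open>D\<^sup>2 x = \<Sum>\<^sub>e \<langle>x, D e\<rangle> D e\<close>. The trace condition says that the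
  numbers \<open>\<parallel>D e\<parallel>\<^sup>2\<close> are summable; hence all but countably many terms vanish and the others can be
  enumerated.\<close>

lemma square_nuclear:
  fixes D :: "'a::complex_hilbert \<Rightarrow> 'a"
  assumes D: "positive_op D" and E: "onb E" and tr: "(\<lambda>e. cinner (D (D e)) e) summable_on E"
  shows "nuclear (\<lambda>x. D (D x))"
proof -
  have "cinner (D (D e)) e = complex_of_real ((norm (D e))\<^sup>2)" for e
    by (simp add: positive_op_symmetric[OF D, of "D e"] cinner_self)
  then have "(\<lambda>e. Re (complex_of_real ((norm (D e))\<^sup>2))) summable_on E"
    using summable_on_Re[OF tr] by (simp only:)
  then have sq: "(\<lambda>e. (norm (D e))\<^sup>2) summable_on E" by simp
  define N where "N = {e \<in> E. D e \<noteq> 0}"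
  have "countable N" using summable_countable_real[OF sq] by (simp add: N_def)
  define h where "h = to_nat_on N"
  define u where "u k = (if k \<in> h ` N then D (the_inv_into N h k) else 0)" for k
  have inj: "inj_on h N" unfolding h_def by (rule inj_on_to_nat_on[OF \<open>countable N\<close>])
  have uh: "u (h e) = D e" if "e \<in> N" for e
    using that by (simp add: u_def the_inv_into_f_f[OF inj])
  have enum: "((\<lambda>k. f (u k)) has_sum s) UNIV"
    if "((\<lambda>e. f (D e)) has_sum s) E" and "f 0 = 0"
    for f :: "'a \<Rightarrow> 'b::topological_comm_monoid_add" and s
  proof -
    have "((\<lambda>e. f (D e)) has_sum s) N"
      using that by (subst has_sum_cong_neutral[where T = E and g = "\<lambda>e. f (D e)"]) (auto simp: N_def)
    then have "((\<lambda>e. f (u (h e))) has_sum s) N"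
      by (subst has_sum_cong[where g = "\<lambda>e. f (D e)"]) (auto simp: uh)
    then have "((\<lambda>k. f (u k)) has_sum s) (h ` N)"
      by (subst has_sum_reindex[OF inj]) (simp add: o_def)
    then show ?thesis
      by (subst has_sum_cong_neutral[where T = "h ` N" and g = "\<lambda>k. f (u k)"])
        (auto simp: u_def that(2))
  qed
  have "nuclear_rep u u (\<lambda>x. D (D x))"
    unfolding nuclear_rep_def
  proof (intro conjI allI)
    obtain s where "((\<lambda>e. norm (D e) * norm (D e)) has_sum s) E"
      using sq by (auto simp: summable_on_def power2_eq_square)
    from enum[of "\<lambda>y. norm y * norm y", OF this] show "(\<lambda>k. norm (u k) * norm (u k)) summable_on UNIV"
      by (auto simp: summable_on_def)
    fix x
    have "((\<lambda>e. D (cinner (D x) e *\<^sub>C e)) has_sum D (D x)) E"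
      by (rule has_sum_bounded_linear[OF bounded_op_linear[OF positive_op_bounded[OF D]] onb_expansion[OF E]])
    then have "((\<lambda>e. cinner x (D e) *\<^sub>C D e) has_sum D (D x)) E"
      by (simp add: bounded_op_scaleC[OF positive_op_bounded[OF D]] positive_op_symmetric[OF D])
    from enum[of "\<lambda>y. cinner x y *\<^sub>C y", OF this]
    show "((\<lambda>k. cinner x (u k) *\<^sub>C u k) has_sum D (D x)) UNIV" by simp
  qed
  then show ?thesis by (auto simp: nuclear_def)
qed


section \<open>Polynomials of an operator\<close>

lemma op_poly_eq_sum:
  assumes "degree p \<le> n"
  shows "op_poly p A x = (\<Sum>i\<le>n. coeff p i *\<^sub>C (A ^^ i) (x::'a::complex_hilbert))"
  unfolding op_poly_def using assms
  by (intro sum.mono_neutral_left) (auto simp: coeff_eq_0)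

lemma op_poly_0 [simp]: "op_poly 0 A x = (0::'a::complex_hilbert)"
  by (simp add: op_poly_def)

lemma bounded_op_lincomb:
  assumes A: "bounded_op A"
  shows "A (\<Sum>i\<in>I. c i *\<^sub>C x i) = (\<Sum>i\<in>I. c i *\<^sub>C A (x i))"
proof -
  interpret bounded_linear A using A by (rule bounded_op_linear)
  show ?thesis by (simp add: sum bounded_op_scaleC[OF A])
qed

lemma op_poly_pCons:
  fixes A :: "'a::complex_hilbert \<Rightarrow> 'a"
  assumes A: "bounded_op A"
  shows "op_poly (pCons a p) A x = a *\<^sub>C x + A (op_poly p A x)"
proof -
  have "op_poly (pCons a p) A x = (\<Sum>i\<le>Suc (degree p). coeff (pCons a p) i *\<^sub>C (A ^^ i) x)"
    by (rule op_poly_eq_sum) (rule degree_pCons_le)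
  also have "\<dots> = a *\<^sub>C x + A (op_poly p A x)"
    unfolding sum.atMost_Suc_shift by (simp add: op_poly_def bounded_op_lincomb[OF A])
  finally show ?thesis .
qed

lemma op_poly_1 [simp]: "op_poly 1 A x = (x::'a::complex_hilbert)"
  by (simp add: op_poly_def)

lemma op_poly_add: "op_poly (p + q) A x = op_poly p A x + op_poly q A (x::'a::complex_hilbert)"
proof -
  let ?n = "max (degree p) (degree q)"
  have "op_poly (p + q) A x = (\<Sum>i\<le>?n. coeff (p + q) i *\<^sub>C (A ^^ i) x)"
    by (rule op_poly_eq_sum) (rule degree_add_le_max)
  then show ?thesis
    by (simp add: op_poly_eq_sum[of p ?n] op_poly_eq_sum[of q ?n] scaleC_add_left sum.distrib)
qed

lemma op_poly_smult: "op_poly (smult c p) A x = c *\<^sub>C op_poly p A (x::'a::complex_hilbert)"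
  using op_poly_eq_sum[OF degree_smult_le, of c p A x]
  by (simp add: op_poly_def scaleC_sum_right scaleC_scaleC)

lemma op_poly_mult:
  fixes A :: "'a::complex_hilbert \<Rightarrow> 'a"
  assumes A: "bounded_op A"
  shows "op_poly (p * q) A x = op_poly p A (op_poly q A x)"
  by (induction p) (simp_all add: op_poly_add op_poly_smult op_poly_pCons[OF A])

lemma pderiv_sum: "pderiv (\<Sum>i\<in>I. f i) = (\<Sum>i\<in>I. pderiv (f i))"
  by (induction I rule: infinite_finite_induct) (simp_all add: pderiv_add)

lemma poly_antiderivative: "\<exists>q. pderiv q = (p::complex poly)"
proof
  have "pderiv (\<Sum>i\<le>degree p. monom (coeff p i / of_nat (Suc i)) (Suc i))
      = (\<Sum>i\<le>degree p. monom (coeff p i) i)"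
    unfolding pderiv_sum by (intro sum.cong refl) (simp add: pderiv_monom del: of_nat_Suc)
  also have "\<dots> = p" by (rule poly_as_sum_of_monoms)
  finally show "pderiv (\<Sum>i\<le>degree p. monom (coeff p i / of_nat (Suc i)) (Suc i)) = p" .
qed


section \<open>The trace form of an almost commuting pair\<close>

locale almost_commuting_pair =
  fixes X Y :: "'a::complex_hilbert \<Rightarrow> 'a" and E :: "'a set"
  assumes self_adjoint_X: "self_adjoint X" and self_adjoint_Y: "self_adjoint Y"
    and nuclear_commutator_YX: "nuclear (commutator Y X)"
    and onb_E: "onb E"
begin

inductive alg :: "('a \<Rightarrow> 'a) \<Rightarrow> bool" where
  alg_id: "alg (\<lambda>x. x)"
| alg_X: "alg X"
| alg_Y: "alg Y"
| alg_add: "alg A \<Longrightarrow> alg B \<Longrightarrow> alg (\<lambda>x. A x + B x)"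
| alg_scale: "alg A \<Longrightarrow> alg (\<lambda>x. c *\<^sub>C A x)"
| alg_comp: "alg A \<Longrightarrow> alg B \<Longrightarrow> alg (\<lambda>x. A (B x))"

text \<open>Adjoints are needed for the right ideal property of nuclear operators and for the existence of
  \<open>\<bar>A\<bar>\<close>. On this algebra they are explicit, as the generators are self-adjoint.\<close>

lemma alg_adjoint_pair: "alg A \<Longrightarrow> \<exists>B. adjoint_pair A B"
proof (induction rule: alg.induct)
  case alg_id
  then show ?case by (auto simp: adjoint_pair_def intro!: exI[of _ "\<lambda>x. x"] bounded_op_id)
next
  case alg_X
  then show ?case using self_adjoint_X by (auto simp: adjoint_pair_def self_adjoint_def)
next
  case alg_Y
  then show ?case using self_adjoint_Y by (auto simp: adjoint_pair_def self_adjoint_def)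
next
  case (alg_add A B)
  then obtain A' B' where "adjoint_pair A A'" "adjoint_pair B B'" by blast
  then have "adjoint_pair (\<lambda>x. A x + B x) (\<lambda>x. A' x + B' x)"
    by (simp add: adjoint_pair_def bounded_op_plus cinner_add_left cinner_add_right)
  then show ?case by blast
next
  case (alg_scale A c)
  then obtain A' where "adjoint_pair A A'" by blast
  then have "adjoint_pair (\<lambda>x. c *\<^sub>C A x) (\<lambda>x. cnj c *\<^sub>C A' x)"
    by (simp add: adjoint_pair_def bounded_op_scale cinner_scaleC_left cinner_scaleC_right)
  then show ?case by blast
next
  case (alg_comp A B)
  then obtain A' B' where "adjoint_pair A A'" "adjoint_pair B B'" by blast
  then have "adjoint_pair (\<lambda>x. A (B x)) (\<lambda>x. B' (A' x))"
    by (simp add: adjoint_pair_def bounded_op_comp[of A B] bounded_op_comp[of B' A'])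
  then show ?case by blast
qed

lemma alg_bounded: "alg A \<Longrightarrow> bounded_op A"
  using alg_adjoint_pair by (auto simp: adjoint_pair_def)

lemma alg_zero: "alg (\<lambda>x. 0)"
  using alg_scale[OF alg_id, of 0] by simp

lemma alg_diff: "alg A \<Longrightarrow> alg B \<Longrightarrow> alg (\<lambda>x. A x - B x)"
  using alg_add[OF _ alg_scale[of B "-1"], of A] by (simp add: scaleC_minus_one)

lemma alg_commutator: "alg A \<Longrightarrow> alg B \<Longrightarrow> alg (commutator A B)"
  unfolding commutator_def by (intro alg_diff alg_comp[of A B] alg_comp[of B A])

lemma alg_sum: "(\<And>i. i \<in> I \<Longrightarrow> alg (A i)) \<Longrightarrow> alg (\<lambda>x. \<Sum>i\<in>I. A i x)"
  by (induction I rule: infinite_finite_induct) (auto simp: alg_zero intro!: alg_add)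

lemma alg_op_poly:
  assumes "alg A"
  shows "alg (op_poly p A)"
proof (induction p)
  case 0
  then show ?case using alg_zero by (simp add: op_poly_def)
next
  case (pCons a p)
  have "op_poly (pCons a p) A = (\<lambda>x. a *\<^sub>C x + A (op_poly p A x))"
    using op_poly_pCons[OF alg_bounded[OF assms]] by (rule ext)
  then show ?case
    using alg_add[OF alg_scale[OF alg_id] alg_comp[OF assms pCons(2)]] by simp
qed

text \<open>The operators \<open>B\<close> for which \<open>[C, B]\<close> is nuclear form an algebra, because \<open>[C, \<cdot>]\<close> is a
  derivation and the nuclear operators form an ideal.\<close>

lemma nuclear_commutator_generators:
  assumes C: "alg C" "nuclear (commutator C X)" "nuclear (commutator C Y)" and "alg B"
  shows "nuclear (commutator C B)"
  using assms(4)
proof (induction rule: alg.induct)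
  case (alg_add A B)
  have "commutator C (\<lambda>x. A x + B x) = (\<lambda>x. commutator C A x + commutator C B x)"
    by (simp add: commutator_def bounded_op_add[OF alg_bounded[OF C(1)]] add_diff_add)
  then show ?case using alg_add nuclear_add by simp
next
  case (alg_scale A c)
  have "commutator C (\<lambda>x. c *\<^sub>C A x) = (\<lambda>x. c *\<^sub>C commutator C A x)"
    by (simp add: commutator_def bounded_op_scaleC[OF alg_bounded[OF C(1)]] scaleC_diff_right)
  then show ?case using alg_scale nuclear_scale by simp
next
  case (alg_comp A B)
  have "commutator C (\<lambda>x. A (B x)) = (\<lambda>x. commutator C A (B x) + A (commutator C B x))"
    by (simp add: commutator_def bounded_op_diff[OF alg_bounded[OF alg_comp(1)]])
  moreover obtain B' where B': "adjoint_pair B B'" using alg_adjoint_pair[OF alg_comp(2)] ..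
  have "nuclear (\<lambda>x. commutator C A (B x) + A (commutator C B x))"
    by (rule nuclear_add[OF nuclear_comp_right[OF alg_comp(3) B'] nuclear_comp_left[OF alg_comp(4)]])
      (rule alg_bounded[OF alg_comp(1)])
  ultimately show ?case by simp
qed (use C in \<open>auto simp: commutator_def nuclear_zero\<close>)

lemma commutator_swap: "commutator A B = (\<lambda>x. (-1) *\<^sub>C commutator B A (x::'a))"
  by (simp add: commutator_def scaleC_minus_one)

lemma nuclear_commutator_swap: "nuclear (commutator B A) \<Longrightarrow> nuclear (commutator A (B :: 'a \<Rightarrow> 'a))"
  unfolding commutator_swap[of A B] by (rule nuclear_scale)

lemma nuclear_commutator:
  assumes "alg A" "alg B"
  shows "nuclear (commutator A B)"
proof -
  have self: "commutator Z Z = (\<lambda>x. 0)" for Z :: "'a \<Rightarrow> 'a" by (simp add: commutator_def)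
  have "nuclear (commutator X A)"
    by (rule nuclear_commutator_generators[OF alg_X _ _ assms(1)])
      (simp_all add: self nuclear_zero nuclear_commutator_swap[OF nuclear_commutator_YX])
  moreover have "nuclear (commutator Y A)"
    by (rule nuclear_commutator_generators[OF alg_Y _ _ assms(1)])
      (simp_all add: self nuclear_zero nuclear_commutator_YX)
  ultimately show ?thesis
    by (intro nuclear_commutator_generators[OF assms(1) _ _ assms(2)] nuclear_commutator_swap[of _ A])
qed

definition trace_form :: "('a \<Rightarrow> 'a) \<Rightarrow> ('a \<Rightarrow> 'a) \<Rightarrow> complex" where
  "trace_form A B = op_trace (commutator A B)"

lemma trace_form_swap: "trace_form A B = - trace_form B A"
  unfolding trace_form_def commutator_swap[of A B] op_trace_scale by simp

lemma trace_form_add_left: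
  assumes "alg A" "alg B" "alg C"
  shows "trace_form (\<lambda>x. A x + B x) C = trace_form A C + trace_form B C"
proof -
  have "commutator (\<lambda>x. A x + B x) C = (\<lambda>x. commutator A C x + commutator B C x)"
    by (simp add: commutator_def bounded_op_add[OF alg_bounded[OF assms(3)]] add_diff_add)
  then show ?thesis
    unfolding trace_form_def using assms by (simp add: op_trace_add[OF onb_E] nuclear_commutator)
qed

lemma trace_form_add_right:
  assumes "alg A" "alg B" "alg C"
  shows "trace_form C (\<lambda>x. A x + B x) = trace_form C A + trace_form C B"
  using trace_form_add_left[OF assms] by (simp add: trace_form_swap[of C])

lemma trace_form_scale_left:
  assumes "alg C"
  shows "trace_form (\<lambda>x. c *\<^sub>C A x) C = c * trace_form A C"
proof -
  have "commutator (\<lambda>x. c *\<^sub>C A x) C = (\<lambda>x. c *\<^sub>C commutator A C x)"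
    by (simp add: commutator_def bounded_op_scaleC[OF alg_bounded[OF assms]] scaleC_diff_right)
  then show ?thesis by (simp add: trace_form_def op_trace_scale)
qed

lemma trace_form_id_left: "alg C \<Longrightarrow> trace_form (\<lambda>x. x) C = 0"
  by (simp add: trace_form_def commutator_def op_trace_zero)

text \<open>The trace of a commutator is insensitive to a nuclear perturbation \<open>S\<close> of one factor,
  because \<open>S B\<close> and \<open>B S\<close> have the same trace. Hence only the classes of the operators modulo nuclear
  operators matter, and these commute.\<close>

lemma trace_form_cong_left:
  assumes "alg A" "alg A'" "alg B" and S: "nuclear (\<lambda>x. A x - A' x)"
  shows "trace_form A B = trace_form A' B"
proof -
  obtain B' where B': "adjoint_pair B B'" using alg_adjoint_pair[OF assms(3)] ..
  have "trace_form A B - trace_form A' B = op_trace (\<lambda>x. commutator A B x - commutator A' B x)"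
    unfolding trace_form_def using assms by (simp add: op_trace_diff[OF onb_E] nuclear_commutator)
  also have "\<dots> = op_trace (\<lambda>x. (A (B x) - A' (B x)) - B (A x - A' x))"
    by (simp add: commutator_def bounded_op_diff[OF alg_bounded[OF assms(3)]] algebra_simps)
  also have "\<dots> = op_trace (\<lambda>x. A (B x) - A' (B x)) - op_trace (\<lambda>x. B (A x - A' x))"
    by (rule op_trace_diff[OF onb_E nuclear_comp_right[OF S B'] nuclear_comp_left[OF S]])
      (rule alg_bounded[OF assms(3)])
  also have "\<dots> = 0"
    using op_trace_commute[OF onb_E S B'] by simp
  finally show ?thesis by simp
qed

lemma trace_form_cong_right:
  assumes "alg B" "alg B'" "alg A" and "nuclear (\<lambda>x. B x - B' x)"
  shows "trace_form A B = trace_form A B'"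
  using trace_form_cong_left[OF assms] by (simp add: trace_form_swap[of A])

text \<open>The operator identity \<open>[A B, C] = [A, B C] + [B, C A]\<close>. Once factors may be reordered modulo nuclear
  operators, it says that \<open>A \<mapsto> trace_form A \<cdot>\<close> is a derivation.\<close>

lemma trace_form_comp_left:
  assumes "alg A" "alg B" "alg C"
  shows "trace_form (\<lambda>x. A (B x)) C = trace_form A (\<lambda>x. B (C x)) + trace_form B (\<lambda>x. C (A x))"
proof -
  have "commutator (\<lambda>x. A (B x)) C
      = (\<lambda>x. commutator A (\<lambda>x. B (C x)) x + commutator B (\<lambda>x. C (A x)) x)"
    by (simp add: commutator_def)
  then show ?thesis
    unfolding trace_form_def using assms
    by (simp add: op_trace_add[OF onb_E] nuclear_commutator alg_comp[of B C] alg_comp[of C A])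
qed

text \<open>A derivation satisfies the chain rule. The induction step is the product rule for \<open>Z p(Z)\<close>.\<close>

lemma trace_form_op_poly:
  assumes Z: "alg Z" and G: "alg G"
  shows "trace_form (op_poly \<alpha> Z) (\<lambda>x. op_poly \<phi> Z (G x)) = trace_form Z (\<lambda>x. op_poly (pderiv \<alpha> * \<phi>) Z (G x))"
proof (induction \<alpha> arbitrary: \<phi>)
  case 0
  have "commutator C (\<lambda>x. 0) = (\<lambda>x. 0)" "commutator (\<lambda>x. 0) C = (\<lambda>x. 0)" if "alg C" for C
    using bounded_op_zero[OF alg_bounded[OF that]] by (simp_all add: commutator_def)
  moreover have "op_poly 0 Z = (\<lambda>x. 0)" by (simp add: fun_eq_iff)
  ultimately show ?case
    by (simp add: trace_form_def op_trace_zero Z alg_comp[OF alg_op_poly[OF Z] G])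
next
  case (pCons a p)
  note bZ = alg_bounded[OF Z] and aP = alg_op_poly[OF Z]
  define F where "F = (\<lambda>x. op_poly \<phi> Z (G x))"
  have F: "alg F" unfolding F_def by (rule alg_comp[OF aP G])
  have "op_poly (pCons a p) Z = (\<lambda>x. a *\<^sub>C x + Z (op_poly p Z x))"
    using op_poly_pCons[OF bZ] by (rule ext)
  then have "trace_form (op_poly (pCons a p) Z) F = trace_form (\<lambda>x. a *\<^sub>C x) F + trace_form (\<lambda>x. Z (op_poly p Z x)) F"
    by (simp add: trace_form_add_left[OF alg_scale[OF alg_id] alg_comp[OF Z aP] F])
  also have "trace_form (\<lambda>x. a *\<^sub>C x) F = 0"
    using trace_form_scale_left[OF F, of a "\<lambda>x. x"] trace_form_id_left[OF F] by simp
  also have "trace_form (\<lambda>x. Z (op_poly p Z x)) F = trace_form Z (\<lambda>x. op_poly p Z (F x)) + trace_form (op_poly p Z) (\<lambda>x. F (Z x))"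
    by (rule trace_form_comp_left[OF Z aP F])
  \<comment> \<open>Move \<open>Z\<close> to the left of \<open>F\<close>, where it is absorbed into the polynomial \<open>\<phi>\<close>.\<close>
  also have "trace_form (op_poly p Z) (\<lambda>x. F (Z x)) = trace_form (op_poly p Z) (\<lambda>x. Z (F x))"
    using nuclear_commutator[OF F Z]
    by (intro trace_form_cong_right alg_comp[OF F Z] alg_comp[OF Z F] aP) (simp add: commutator_def)
  also have "(\<lambda>x. Z (F x)) = (\<lambda>x. op_poly (pCons 0 \<phi>) Z (G x))"
    by (simp add: F_def op_poly_pCons[OF bZ])
  also have "trace_form (op_poly p Z) \<dots> = trace_form Z (\<lambda>x. op_poly (pderiv p * pCons 0 \<phi>) Z (G x))"
    by (rule pCons(2))
  also have "(\<lambda>x. op_poly p Z (F x)) = (\<lambda>x. op_poly (p * \<phi>) Z (G x))"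
    by (simp add: F_def op_poly_mult[OF bZ])
  also have "0 + (trace_form Z \<dots> + trace_form Z (\<lambda>x. op_poly (pderiv p * pCons 0 \<phi>) Z (G x)))
      = trace_form Z (\<lambda>x. op_poly (p * \<phi>) Z (G x) + op_poly (pderiv p * pCons 0 \<phi>) Z (G x))"
    by (subst trace_form_add_right[OF alg_comp[OF aP G] alg_comp[OF aP G] Z]) simp
  also have "(\<lambda>x. op_poly (p * \<phi>) Z (G x) + op_poly (pderiv p * pCons 0 \<phi>) Z (G x))
      = (\<lambda>x. op_poly (pderiv (pCons a p) * \<phi>) Z (G x))"
    by (simp add: pderiv_pCons distrib_right flip: op_poly_add)
  finally show ?case unfolding F_def .
qed

text \<open>By the chain rule both sides equal \<open>trace_form Z (q'(Z) G)\<close>. This moves the factor \<open>\<phi>(Z)\<close> to the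
  other side, so that the trace form of a mixed product reduces to one of the kind that the
  principal function computes.\<close>

lemma trace_form_antiderivative:
  assumes Z: "alg Z" and G: "alg G" and "pderiv q = pderiv \<alpha> * \<phi>"
  shows "trace_form (op_poly \<alpha> Z) (\<lambda>x. op_poly \<phi> Z (G x)) = trace_form (op_poly q Z) G"
  using trace_form_op_poly[OF Z G, of \<alpha> \<phi>] trace_form_op_poly[OF Z G, of q 1] assms(3) by simp

text \<open>Split the left factor by the product rule and reorder the right factors modulo nuclear operators,
  so that in each summand the function of \<open>X\<close> (respectively \<open>Y\<close>) in the right factor can be absorbed
  into the left one.\<close>

lemma trace_form_products:
  assumes q: "pderiv q = pderiv \<alpha> * \<phi>" and w: "pderiv w = pderiv \<psi> * \<beta>"
  shows "trace_form (\<lambda>x. op_poly \<alpha> X (op_poly \<psi> Y x)) (\<lambda>x. op_poly \<phi> X (op_poly \<beta> Y x))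
    = trace_form (op_poly w Y) (op_poly (\<phi> * \<alpha>) X) - trace_form (op_poly (\<psi> * \<beta>) Y) (op_poly q X)"
proof -
  note PX = alg_op_poly[OF alg_X] and PY = alg_op_poly[OF alg_Y]
  note bX = alg_bounded[OF alg_X] and bY = alg_bounded[OF alg_Y]
  obtain Bs where Bs: "adjoint_pair (op_poly \<beta> Y) Bs" using alg_adjoint_pair[OF PY] ..
  obtain As where As: "adjoint_pair (op_poly \<alpha> X) As" using alg_adjoint_pair[OF PX] ..
  have "trace_form (\<lambda>x. op_poly \<alpha> X (op_poly \<psi> Y x)) (\<lambda>x. op_poly \<phi> X (op_poly \<beta> Y x))
    = trace_form (op_poly \<alpha> X) (\<lambda>x. op_poly \<psi> Y (op_poly \<phi> X (op_poly \<beta> Y x)))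
      + trace_form (op_poly \<psi> Y) (\<lambda>x. op_poly \<phi> X (op_poly \<beta> Y (op_poly \<alpha> X x)))"
    by (rule trace_form_comp_left[OF PX PY alg_comp[OF PX PY]])
  also have "trace_form (op_poly \<alpha> X) (\<lambda>x. op_poly \<psi> Y (op_poly \<phi> X (op_poly \<beta> Y x)))
    = trace_form (op_poly \<alpha> X) (\<lambda>x. op_poly \<phi> X (op_poly \<psi> Y (op_poly \<beta> Y x)))"
    using nuclear_comp_right[OF nuclear_commutator[OF PY PX] Bs]
    by (intro trace_form_cong_right alg_comp[OF PY alg_comp[OF PX PY]] alg_comp[OF PX alg_comp[OF PY PY]] PX)
      (simp add: commutator_def)
  also have "\<dots> = trace_form (op_poly \<alpha> X) (\<lambda>x. op_poly \<phi> X (op_poly (\<psi> * \<beta>) Y x))"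
    by (simp add: op_poly_mult[OF bY])
  also have "\<dots> = trace_form (op_poly q X) (op_poly (\<psi> * \<beta>) Y)"
    by (rule trace_form_antiderivative[OF alg_X PY q])
  also have "trace_form (op_poly \<psi> Y) (\<lambda>x. op_poly \<phi> X (op_poly \<beta> Y (op_poly \<alpha> X x)))
    = trace_form (op_poly \<psi> Y) (\<lambda>x. op_poly \<beta> Y (op_poly \<phi> X (op_poly \<alpha> X x)))"
    using nuclear_comp_right[OF nuclear_commutator[OF PX PY] As]
    by (intro trace_form_cong_right alg_comp[OF PX alg_comp[OF PY PX]] alg_comp[OF PY alg_comp[OF PX PX]] PY)
      (simp add: commutator_def)
  also have "\<dots> = trace_form (op_poly \<psi> Y) (\<lambda>x. op_poly \<beta> Y (op_poly (\<phi> * \<alpha>) X x))"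
    by (simp add: op_poly_mult[OF bX])
  also have "\<dots> = trace_form (op_poly w Y) (op_poly (\<phi> * \<alpha>) X)"
    by (rule trace_form_antiderivative[OF alg_Y PX w])
  finally show ?thesis by (simp add: trace_form_swap[of "op_poly q X"])
qed

lemma commutator_sums:
  assumes A: "\<And>j. alg (A j)" and B: "\<And>k. alg (B k)"
  shows "commutator (\<lambda>x. \<Sum>j\<in>J. c j *\<^sub>C A j x) (\<lambda>x. \<Sum>k\<in>K. d k *\<^sub>C B k x)
    = (\<lambda>x. \<Sum>j\<in>J. \<Sum>k\<in>K. (c j * d k) *\<^sub>C commutator (A j) (B k) x)"
proof
  fix x
  have "(\<Sum>k\<in>K. \<Sum>j\<in>J. (d k * c j) *\<^sub>C B k (A j x)) = (\<Sum>j\<in>J. \<Sum>k\<in>K. (c j * d k) *\<^sub>C B k (A j x))"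
    by (subst sum.swap) (simp add: mult.commute)
  then show "commutator (\<lambda>x. \<Sum>j\<in>J. c j *\<^sub>C A j x) (\<lambda>x. \<Sum>k\<in>K. d k *\<^sub>C B k x) x
    = (\<Sum>j\<in>J. \<Sum>k\<in>K. (c j * d k) *\<^sub>C commutator (A j) (B k) x)"
    by (simp add: commutator_def bounded_op_lincomb[OF alg_bounded[OF A]] bounded_op_lincomb[OF alg_bounded[OF B]] scaleC_sum_right scaleC_scaleC scaleC_diff_right sum_subtractf)
qed

lemma op_trace_commutator_sums:
  assumes A: "\<And>j. alg (A j)" and B: "\<And>k. alg (B k)"
  shows "op_trace (commutator (\<lambda>x. \<Sum>j\<in>J. c j *\<^sub>C A j x) (\<lambda>x. \<Sum>k\<in>K. d k *\<^sub>C B k x))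
    = (\<Sum>j\<in>J. \<Sum>k\<in>K. (c j * d k) * trace_form (A j) (B k))"
  unfolding commutator_sums[OF A B] trace_form_def
  by (simp add: op_trace_sum[OF onb_E] op_trace_scale nuclear_sum nuclear_scale nuclear_commutator A B)

end


section \<open>The trace formula\<close>

lemma has_vector_derivative_poly_of_real:
  "((\<lambda>s. poly p (complex_of_real s)) has_vector_derivative poly (pderiv p) (of_real t)) (at t)"
  by (rule has_vector_derivative_real_field[OF poly_DERIV])

lemma jacobian_det_products:
  assumes "Psi = (\<lambda>t l. \<Sum>j\<in>J. c j * poly (\<alpha> j) (complex_of_real t) * poly (\<psi> j) (complex_of_real l))"
    and "Phi = (\<lambda>t l. \<Sum>k\<in>K. d k * poly (\<phi> k) (complex_of_real t) * poly (\<beta> k) (complex_of_real l))"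
  shows "- jacobian_det Psi Phi t l = (\<Sum>j\<in>J. \<Sum>k\<in>K. (c j * d k) *
    (poly (\<alpha> j * pderiv (\<phi> k)) (of_real t) * poly (pderiv (\<psi> j) * \<beta> k) (of_real l)
      - poly (pderiv (\<alpha> j) * \<phi> k) (of_real t) * poly (\<psi> j * pderiv (\<beta> k)) (of_real l)))"
proof -
  let ?t = "complex_of_real t" and ?l = "complex_of_real l"
  have d1: "vector_derivative (\<lambda>s. \<Sum>j\<in>I. e j * poly (f j) (complex_of_real s) * poly (g j) ?l) (at t)
      = (\<Sum>j\<in>I. e j * poly (pderiv (f j)) ?t * poly (g j) ?l)" for I :: "'i set" and e f g
    by (rule vector_derivative_at) (auto intro!: derivative_eq_intros has_vector_derivative_poly_of_real)
  have d2: "vector_derivative (\<lambda>s. \<Sum>j\<in>I. e j * poly (f j) ?t * poly (g j) (complex_of_real s)) (at l)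
      = (\<Sum>j\<in>I. e j * poly (f j) ?t * poly (pderiv (g j)) ?l)" for I :: "'i set" and e f g
    by (rule vector_derivative_at) (auto intro!: derivative_eq_intros has_vector_derivative_poly_of_real)
  show ?thesis
    unfolding jacobian_det_def assms d1 d2
    by (simp add: sum_product flip: sum_subtractf sum_negf) (intro sum.cong refl; simp add: algebra_simps)
qed

lemma integrable_poly_times:
  assumes r: "integrable (lebesgue_on ({a..b} \<times> {a..b})) (r :: real \<times> real \<Rightarrow> real)"
  shows "integrable (lebesgue_on ({a..b} \<times> {a..b}))
    (\<lambda>(t, l). poly p (complex_of_real t) * poly q (complex_of_real l) * complex_of_real (r (t, l)))"
proof -
  let ?S = "{a..b} \<times> {a..b}"
  let ?f = "\<lambda>z. poly p (complex_of_real (fst z)) * poly q (complex_of_real (snd z))"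
  have cont: "continuous_on UNIV ?f" by (intro continuous_intros)
  have "compact ?S" by (intro compact_Times compact_Icc)
  then have "bounded (?f ` ?S)"
    using cont continuous_on_subset compact_continuous_image compact_imp_bounded by blast
  then obtain C where "\<forall>w \<in> ?f ` ?S. cmod w \<le> C"
    unfolding bounded_iff by blast
  then have C: "cmod (?f z) \<le> C" if "z \<in> ?S" for z
    using that by blast
  have "?f \<in> borel_measurable borel" using cont by (rule borel_measurable_continuous_onI)
  then have f: "?f \<in> borel_measurable (lebesgue_on ?S)"
    by (intro measurable_restrict_space1 measurable_completion) simp
  have "integrable (lebesgue_on ?S) (\<lambda>z. ?f z * complex_of_real (r z))"
  proof (rule Bochner_Integration.integrable_bound)
    show "integrable (lebesgue_on ?S) (\<lambda>z. C * r z)" using r by simp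
    have "(\<lambda>z. complex_of_real (r z)) \<in> borel_measurable (lebesgue_on ?S)"
      using borel_measurable_integrable[OF r] by measurable
    then show "(\<lambda>z. ?f z * complex_of_real (r z)) \<in> borel_measurable (lebesgue_on ?S)"
      by (rule borel_measurable_times[OF f])
    show "AE z in lebesgue_on ?S. norm (?f z * complex_of_real (r z)) \<le> norm (C * r z)"
    proof (rule AE_I2)
      fix z assume "z \<in> space (lebesgue_on ?S)"
      then have "z \<in> ?S" by simp
      from C[OF this] have "cmod (?f z) \<le> \<bar>C\<bar>" by linarith
      then show "norm (?f z * complex_of_real (r z)) \<le> norm (C * r z)"
        using mult_right_mono[of "cmod (?f z)" "\<bar>C\<bar>" "\<bar>r z\<bar>"] by (simp add: norm_mult abs_mult)
    qed
  qed
  then show ?thesis by (simp add: case_prod_unfold)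
qed

text \<open>The positive operator \<open>[T\<^sup>*, T] = 2 D\<^sup>2\<close> is its own absolute value, so its diagonal in a suitable
  basis is summable; and \<open>[Y, X] = i D\<^sup>2\<close>.\<close>

lemma assumption_A_almost_commuting:
  fixes X Y :: "'a::complex_hilbert \<Rightarrow> 'a"
  assumes A: "assumption_A a b T X Y"
  obtains E where "almost_commuting_pair X Y E"
proof -
  let ?C = "commutator (adj T) T"
  obtain D where D: "positive_op D" and C1: "?C = op_scale (- 2 * \<i>) (commutator Y X)"
    and C2: "?C = op_scale 2 (D \<circ> D)"
    using A by (auto simp: assumption_A_def)
  have "positive_op ?C" "trace_class ?C" using A by (auto simp: assumption_A_def)
  then obtain E where E: "onb E" and s: "(\<lambda>e. cinner (?C e) e) summable_on E"
    by (auto simp: trace_class_def op_abs_positive)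
  have "(\<lambda>e. (1/2) * cinner (?C e) e) summable_on E"
    using s by (rule summable_on_cmult_right)
  then have "(\<lambda>e. cinner (D (D e)) e) summable_on E"
    by (simp add: C2 op_scale_def cinner_scaleC_left)
  then have "nuclear (\<lambda>x. D (D x))" by (rule square_nuclear[OF D E])
  then have N: "nuclear (\<lambda>x. \<i> *\<^sub>C D (D x))" by (rule nuclear_scale)
  have "commutator Y X x = \<i> *\<^sub>C D (D x)" for x
  proof -
    have "(- 2 * \<i>) *\<^sub>C commutator Y X x = 2 *\<^sub>C D (D x)"
      using C1 C2 by (simp add: op_scale_def fun_eq_iff)
    then have "(\<i> / 2) *\<^sub>C (- 2 * \<i>) *\<^sub>C commutator Y X x = (\<i> / 2) *\<^sub>C 2 *\<^sub>C D (D x)" by simp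
    then show ?thesis by (simp add: scaleC_scaleC)
  qed
  then have "commutator Y X = (\<lambda>x. \<i> *\<^sub>C D (D x))" by (rule ext)
  with N have "nuclear (commutator Y X)" by simp
  then have "almost_commuting_pair X Y E"
    using A E by unfold_locales (auto simp: assumption_A_def)
  then show thesis by (rule that)
qed

context almost_commuting_pair
begin

lemma trace_form_principal_function:
  assumes "principal_function a b X Y r"
  shows "- \<i> * trace_form (op_poly \<psi> Y) (op_poly \<phi> X) = (LINT (t, l) | lebesgue_on ({a..b} \<times> {a..b}).
    poly (pderiv \<phi>) (of_real t) * poly (pderiv \<psi>) (of_real l) * of_real (r (t, l)))"
  using assms by (simp add: principal_function_def trace_form_def op_scale_def op_trace_scale[symmetric])

text \<open>The two reduced trace forms contribute \<open>(\<phi> \<alpha>)' \<psi>' \<beta> - \<alpha>' \<phi> (\<psi> \<beta>)'\<close>, in which the terms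
  \<open>\<alpha>' \<phi> \<psi>' \<beta>\<close> cancel.\<close>

lemma trace_form_products_integral:
  assumes r: "principal_function a b X Y r"
  shows "- \<i> * trace_form (\<lambda>x. op_poly \<alpha> X (op_poly \<psi> Y x)) (\<lambda>x. op_poly \<phi> X (op_poly \<beta> Y x))
    = (LINT (t, l) | lebesgue_on ({a..b} \<times> {a..b}).
        (poly (\<alpha> * pderiv \<phi>) (of_real t) * poly (pderiv \<psi> * \<beta>) (of_real l)
          - poly (pderiv \<alpha> * \<phi>) (of_real t) * poly (\<psi> * pderiv \<beta>) (of_real l)) * of_real (r (t, l)))"
proof -
  let ?L = "lebesgue_on ({a..b} \<times> {a..b})"
  let ?I = "\<lambda>p q (t, l). poly p (complex_of_real t) * poly q (complex_of_real l) * complex_of_real (r (t, l))"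
  have int: "integrable ?L (?I p q)" for p q
    using r by (intro integrable_poly_times) (simp add: principal_function_def)
  obtain q where q: "pderiv q = pderiv \<alpha> * \<phi>" using poly_antiderivative by blast
  obtain w where w: "pderiv w = pderiv \<psi> * \<beta>" using poly_antiderivative by blast
  have "- \<i> * trace_form (\<lambda>x. op_poly \<alpha> X (op_poly \<psi> Y x)) (\<lambda>x. op_poly \<phi> X (op_poly \<beta> Y x))
      = (- \<i> * trace_form (op_poly w Y) (op_poly (\<phi> * \<alpha>) X)) - (- \<i> * trace_form (op_poly (\<psi> * \<beta>) Y) (op_poly q X))"
    unfolding trace_form_products[OF q w] by (simp add: algebra_simps)
  also have "\<dots> = integral\<^sup>L ?L (?I (pderiv (\<phi> * \<alpha>)) (pderiv \<psi> * \<beta>))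
      - integral\<^sup>L ?L (?I (pderiv \<alpha> * \<phi>) (pderiv (\<psi> * \<beta>)))"
    unfolding trace_form_principal_function[OF r] q w by simp
  also have "\<dots> = (\<integral>z. ?I (pderiv (\<phi> * \<alpha>)) (pderiv \<psi> * \<beta>) z
      - ?I (pderiv \<alpha> * \<phi>) (pderiv (\<psi> * \<beta>)) z \<partial>?L)"
    by (rule Bochner_Integration.integral_diff[OF int int, symmetric])
  also have "\<dots> = (\<integral>(t, l). (poly (\<alpha> * pderiv \<phi>) (of_real t) * poly (pderiv \<psi> * \<beta>) (of_real l)
          - poly (pderiv \<alpha> * \<phi>) (of_real t) * poly (\<psi> * pderiv \<beta>) (of_real l)) * of_real (r (t, l)) \<partial>?L)"
    by (intro Bochner_Integration.integral_cong refl) (auto simp: pderiv_mult algebra_simps)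
  finally show ?thesis .
qed

end

theorem theorem2p11:
  fixes T X Y PsiXY PhiXY :: "'a::complex_hilbert \<Rightarrow> 'a"
    and a b :: real
    and r :: "real \<times> real \<Rightarrow> real"
    and n m :: nat
    and c d :: "nat \<Rightarrow> complex"
    and \<alpha> \<psi> \<phi> \<beta> :: "nat \<Rightarrow> complex poly"
    and Psi Phi :: "real \<Rightarrow> real \<Rightarrow> complex"
  assumes "separable_space (euclidean :: 'a topology)"
    and "assumption_A a b T X Y"
    and "principal_function a b X Y r"
    and "Psi = (\<lambda>t l. \<Sum>j=1..n. c j * poly (\<alpha> j) (of_real t) * poly (\<psi> j) (of_real l))"
    and "Phi = (\<lambda>t l. \<Sum>k=1..m. d k * poly (\<phi> k) (of_real t) * poly (\<beta> k) (of_real l))"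
    and "PsiXY = (\<lambda>x. \<Sum>j=1..n. c j *\<^sub>C op_poly (\<alpha> j) X (op_poly (\<psi> j) Y x))"
    and "PhiXY = (\<lambda>x. \<Sum>k=1..m. d k *\<^sub>C op_poly (\<phi> k) X (op_poly (\<beta> k) Y x))"
  shows "trace_class (op_scale (- \<i>) (commutator PsiXY PhiXY)) \<and>
    op_trace (op_scale (- \<i>) (commutator PsiXY PhiXY)) =
      (LINT (t, l) | lebesgue_on ({a..b} \<times> {a..b}). - jacobian_det Psi Phi t l * of_real (r (t, l)))"
proof -
  obtain E where "almost_commuting_pair X Y E"
    using assumption_A_almost_commuting[OF assms(2)] .
  then interpret almost_commuting_pair X Y E .
  note r = assms(3)
  define A where "A j = (\<lambda>x. op_poly (\<alpha> j) X (op_poly (\<psi> j) Y x))" for j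
  define B where "B k = (\<lambda>x. op_poly (\<phi> k) X (op_poly (\<beta> k) Y x))" for k
  have algA: "alg (A j)" and algB: "alg (B k)" for j k
    unfolding A_def B_def by (rule alg_comp; rule alg_op_poly, rule alg_X alg_Y)+
  have Psi_A: "PsiXY = (\<lambda>x. \<Sum>j=1..n. c j *\<^sub>C A j x)" and Phi_B: "PhiXY = (\<lambda>x. \<Sum>k=1..m. d k *\<^sub>C B k x)"
    by (simp_all add: assms A_def B_def)
  have alg_Psi: "alg PsiXY" and alg_Phi: "alg PhiXY"
    unfolding Psi_A Phi_B by (intro alg_sum alg_scale algA algB)+
  let ?C = "op_scale (- \<i>) (commutator PsiXY PhiXY)"
  have "alg ?C"
    unfolding op_scale_def by (rule alg_scale[OF alg_commutator[OF alg_Psi alg_Phi]])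
  then obtain C' where "adjoint_pair ?C C'" using alg_adjoint_pair by blast
  moreover have "nuclear ?C"
    unfolding op_scale_def by (rule nuclear_scale[OF nuclear_commutator[OF alg_Psi alg_Phi]])
  ultimately have "trace_class ?C"
    using nuclear_imp_trace_class[OF onb_E] by blast
  moreover have "op_trace ?C = (LINT (t, l) | lebesgue_on ({a..b} \<times> {a..b}).
      - jacobian_det Psi Phi t l * of_real (r (t, l)))"
  proof -
    let ?L = "lebesgue_on ({a..b} \<times> {a..b})"
    define F where "F j k = (\<lambda>(t, l). (poly (\<alpha> j * pderiv (\<phi> k)) (complex_of_real t)
        * poly (pderiv (\<psi> j) * \<beta> k) (complex_of_real l)
      - poly (pderiv (\<alpha> j) * \<phi> k) (complex_of_real t)
        * poly (\<psi> j * pderiv (\<beta> k)) (complex_of_real l)) * complex_of_real (r (t, l)))" for j k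
    have int: "integrable ?L (F j k)" for j k
    proof -
      have "integrable ?L r" using r by (simp add: principal_function_def)
      note i = integrable_poly_times[OF this]
      from Bochner_Integration.integrable_diff[OF
          i[of "\<alpha> j * pderiv (\<phi> k)" "pderiv (\<psi> j) * \<beta> k"] i[of "pderiv (\<alpha> j) * \<phi> k" "\<psi> j * pderiv (\<beta> k)"]]
      show ?thesis by (simp only: F_def case_prod_unfold left_diff_distrib)
    qed
    have "op_trace ?C = - \<i> * (\<Sum>j=1..n. \<Sum>k=1..m. (c j * d k) * trace_form (A j) (B k))"
      unfolding op_scale_def op_trace_scale Psi_A Phi_B op_trace_commutator_sums[OF algA algB] ..
    also have "\<dots> = (\<Sum>j=1..n. \<Sum>k=1..m. (c j * d k) * (- \<i> * trace_form (A j) (B k)))"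
      by (simp add: sum_distrib_left mult_ac)
    also have "\<dots> = (\<Sum>j=1..n. \<Sum>k=1..m. (c j * d k) * integral\<^sup>L ?L (F j k))"
      unfolding A_def B_def F_def trace_form_products_integral[OF r] ..
    also have "\<dots> = (\<integral>z. (\<Sum>j=1..n. \<Sum>k=1..m. (c j * d k) * F j k z) \<partial>?L)"
      by (simp add: int)
    also have "\<dots> = (\<integral>(t, l). - jacobian_det Psi Phi t l * of_real (r (t, l)) \<partial>?L)"
      unfolding jacobian_det_products[OF assms(4,5)]
      by (intro Bochner_Integration.integral_cong refl) (auto simp: F_def sum_distrib_right mult.assoc)
    finally show ?thesis .
  qed
  ultimately show ?thesis ..
qed

end
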